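(* Let $k\ge 2$ and let $\{p_j\}$ be a tame sequence of points in $\mathbb{C}^k$. Then there exists a collection $\{\Omega_j\}$ of pairwise disjoint Short $\mathbb{C}^k$'s in $\mathbb{C}^k$ with $p_j\in\Omega_j$ for every $j$.
   Context: A sequence of points $\{p_j\}$ in $\mathbb{C}^k$ is tame if there exists a holomorphic automorphism $\phi$ of $\mathbb{C}^k$ such that $\phi(p_j)=je_1$ for every $j$, where $e_1=(1,0,\ldots,0)$. A Short $\mathbb{C}^k$ is a proper subdomain $\Omega\subset\mathbb{C}^k$ such that: (i) $\Omega=\bigcup_n\Omega_n$ with $\Omega_n\subset\Omega_{n+1}$, where each $\Omega_n$ is biholomorphic to the unit ball $B^k(0;1)$; (ii) the infinitesimal Kobayashi metric of $\Omega$ vanishes identically; (iii) $\Omega$ admits a non-constant plurisubharmonic function that is bounded above. *)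

theory Defs
  imports "HOL-Complex_Analysis.Complex_Analysis"
begin

text \<open>Complex Euclidean space of dimension \<open>CARD('n)\<close> is \<^typ>\<open>complex ^ 'n\<close>, whose library norm
  is the Hermitian one; \<open>ball 0 1\<close> is therefore the Euclidean unit ball.\<close>

text \<open>To be used on open sets: differentiability is with respect to a full neighbourhood
  of each point.\<close>

definition holomorphic_map_on ::
    "(complex ^ 'n::finite \<Rightarrow> complex ^ 'm::finite) \<Rightarrow> (complex ^ 'n) set \<Rightarrow> bool" where
  "holomorphic_map_on f S \<longleftrightarrow>
     (\<forall>x\<in>S. \<exists>f'. (f has_derivative f') (at x) \<and> (\<forall>c v. f' (c *s v) = c *s f' v))"

definition biholomorphic :: "(complex ^ 'n::finite) set \<Rightarrow> (complex ^ 'm::finite) set \<Rightarrow> bool" where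
  "biholomorphic A B \<longleftrightarrow> open A \<and> open B \<and>
     (\<exists>f g. homeomorphism A B f g \<and> holomorphic_map_on f A \<and> holomorphic_map_on g B)"

definition holomorphic_automorphism :: "(complex ^ 'n::finite \<Rightarrow> complex ^ 'n) \<Rightarrow> bool" where
  "holomorphic_automorphism \<phi> \<longleftrightarrow>
     bij \<phi> \<and> holomorphic_map_on \<phi> UNIV \<and> holomorphic_map_on (inv \<phi>) UNIV"

text \<open>The finite index type has no distinguished first element, so the index \<open>i\<close> of the
  coordinate vector \<open>e\<^sub>1 = axis i 1\<close> is a parameter. Sequences start at index 0; a sequence
  \<open>p\<^sub>1, p\<^sub>2, \<dots>\<close> with \<open>\<phi> p\<^sub>j = j e\<^sub>1\<close> is covered by adding the term \<open>p\<^sub>0 = inv \<phi> 0\<close>.\<close>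

definition tame :: "'n \<Rightarrow> (nat \<Rightarrow> complex ^ 'n::finite) \<Rightarrow> bool" where
  "tame i p \<longleftrightarrow>
     (\<exists>\<phi>. holomorphic_automorphism \<phi> \<and> (\<forall>j. \<phi> (p j) = of_nat j *s axis i 1))"

definition holomorphic_disc_in :: "(complex \<Rightarrow> complex ^ 'n::finite) \<Rightarrow> (complex ^ 'n) set \<Rightarrow> bool" where
  "holomorphic_disc_in \<psi> \<Omega> \<longleftrightarrow>
     (\<forall>i. (\<lambda>\<zeta>. \<psi> \<zeta> $ i) holomorphic_on ball 0 1) \<and> \<psi> ` ball 0 1 \<subseteq> \<Omega>"

text \<open>The infimum of \<open>\<bar>\<alpha>\<bar>\<close> over all holomorphic discs with \<open>\<psi> 0 = z\<close> and \<open>\<alpha> \<psi>' 0 = v\<close>. For open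
  \<open>\<Omega>\<close> and \<open>z \<in> \<Omega>\<close> the set is nonempty (small affine discs) and bounded below by 0, so
  the conditionally complete infimum is the intended one.\<close>

definition kobayashi_metric ::
    "(complex ^ 'n::finite) set \<Rightarrow> complex ^ 'n \<Rightarrow> complex ^ 'n \<Rightarrow> real" where
  "kobayashi_metric \<Omega> z v =
     Inf {cmod \<alpha> | \<alpha>. \<exists>\<psi>. holomorphic_disc_in \<psi> \<Omega> \<and> \<psi> 0 = z \<and>
                        \<alpha> *s (\<chi> i. deriv (\<lambda>\<zeta>. \<psi> \<zeta> $ i) 0) = v}"

definition upper_semicontinuous_on :: "'a::topological_space set \<Rightarrow> ('a \<Rightarrow> ereal) \<Rightarrow> bool" where
  "upper_semicontinuous_on S u \<longleftrightarrow> (\<forall>c. openin (top_of_set S) {x \<in> S. u x < c})"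

text \<open>The mean of an extended-real function over a circle, as the difference of the integrals of
  its positive and negative parts (\<^const>\<open>e2ennreal\<close> sends negative arguments to 0). For an
  upper semicontinuous function without value \<open>\<infinity>\<close> the first integral is finite, so
  \<open>\<infinity> - \<infinity>\<close> does not occur; the mean may be \<open>-\<infinity>\<close>.\<close>

definition circle_mean :: "(complex \<Rightarrow> ereal) \<Rightarrow> complex \<Rightarrow> real \<Rightarrow> ereal" where
  "circle_mean u c r =
     (enn2ereal (\<integral>\<^sup>+\<theta>\<in>{0..2 * pi}. e2ennreal (u (c + of_real r * cis \<theta>)) \<partial>lborel)
      - enn2ereal (\<integral>\<^sup>+\<theta>\<in>{0..2 * pi}. e2ennreal (- u (c + of_real r * cis \<theta>)) \<partial>lborel))
     / ereal (2 * pi)"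

text \<open>The constant \<open>-\<infinity>\<close> counts as subharmonic, so that no case distinction is needed for
  complex lines on which a plurisubharmonic function is identically \<open>-\<infinity>\<close>.\<close>

definition subharmonic_on :: "complex set \<Rightarrow> (complex \<Rightarrow> ereal) \<Rightarrow> bool" where
  "subharmonic_on G u \<longleftrightarrow>
     upper_semicontinuous_on G u \<and> (\<forall>z\<in>G. u z < \<infinity>) \<and>
     (\<forall>c r. r > 0 \<and> cball c r \<subseteq> G \<longrightarrow> u c \<le> circle_mean u c r)"

definition plurisubharmonic_on :: "(complex ^ 'n::finite) set \<Rightarrow> (complex ^ 'n \<Rightarrow> ereal) \<Rightarrow> bool" where
  "plurisubharmonic_on \<Omega> u \<longleftrightarrow>
     upper_semicontinuous_on \<Omega> u \<and> (\<forall>z\<in>\<Omega>. u z < \<infinity>) \<and>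
     (\<forall>a b. subharmonic_on {\<zeta>. a + \<zeta> *s b \<in> \<Omega>} (\<lambda>\<zeta>. u (a + \<zeta> *s b)))"

definition short_Ck :: "(complex ^ 'n::finite) set \<Rightarrow> bool" where
  "short_Ck \<Omega> \<longleftrightarrow>
     open \<Omega> \<and> connected \<Omega> \<and> \<Omega> \<noteq> {} \<and> \<Omega> \<noteq> UNIV \<and>
     (\<exists>\<Omega>n :: nat \<Rightarrow> (complex ^ 'n) set.
        \<Omega> = (\<Union>n. \<Omega>n n) \<and> (\<forall>n. \<Omega>n n \<subseteq> \<Omega>n (Suc n)) \<and>
        (\<forall>n. biholomorphic (\<Omega>n n) (ball (0 :: complex ^ 'n) 1))) \<and>
     (\<forall>z\<in>\<Omega>. \<forall>v. kobayashi_metric \<Omega> z v = 0) \<and>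
     (\<exists>u. plurisubharmonic_on \<Omega> u \<and> \<not> u constant_on \<Omega> \<and>
          (\<exists>M::real. \<forall>z\<in>\<Omega>. u z \<le> ereal M))"

end

theory Submission
  imports Defs
begin

text \<open>
  On bounded sets the automorphism \<open>H\<^sub>\<epsilon>(z, w, y) = (z - (e\<^sup>z - 1 + \<epsilon>w), \<epsilon>(e\<^sup>z - 1 + \<epsilon>w), \<epsilon>y)\<close>
  is a small perturbation of \<open>(z, w, y) \<mapsto> (z + 1 - e\<^sup>z, 0, 0)\<close>, for which \<open>0\<close> is a superattracting fixed point,
  and it commutes with the translation by \<open>2\<pi>i\<close> in \<open>z\<close>. For \<open>\<epsilon>\<^sub>n\<close> decreasing fast enough the
  points attracted to \<open>0\<close> by \<open>H\<^bsub>\<epsilon>\<^sub>n\<^esub> \<circ> \<dots> \<circ> H\<^bsub>\<epsilon>\<^sub>0\<^esub>\<close> form a Short \<open>\<complex>\<^sup>k\<close>, as in Fornaess's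
  construction: preimages of a fixed ball exhaust the basin, the derivatives of the compositions
  \<open>G\<^sub>n\<close> tend to \<open>0\<close> there, and \<open>2\<^sup>-\<^sup>n log (2 max(\<parallel>G\<^sub>n\<parallel>, \<delta>\<^sub>n))\<close> decreases to a nonconstant
  plurisubharmonic function. Translates of the basin by multiples of \<open>2\<pi>i\<close> attract to different
  points, hence are disjoint. A tame sequence is carried to these translates by an automorphism.
\<close>

section \<open>Holomorphic maps and the Kobayashi metric\<close>

lemma holomorphic_map_onE:
  assumes "holomorphic_map_on f S" "x \<in> S"
  obtains f' where "(f has_derivative f') (at x)" "\<And>c v. f' (c *s v) = c *s f' v"
  using assms unfolding holomorphic_map_on_def by blast

lemma holomorphic_map_on_subset:
  "holomorphic_map_on f S \<Longrightarrow> T \<subseteq> S \<Longrightarrow> holomorphic_map_on f T"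
  unfolding holomorphic_map_on_def by blast

lemma holomorphic_map_on_compose:
  assumes "holomorphic_map_on f S" "holomorphic_map_on g T" "f ` S \<subseteq> T"
  shows "holomorphic_map_on (g \<circ> f) S"
  unfolding holomorphic_map_on_def
proof
  fix x assume x: "x \<in> S"
  obtain f' where f': "(f has_derivative f') (at x)" "\<And>c v. f' (c *s v) = c *s f' v"
    using holomorphic_map_onE[OF assms(1) x] by blast
  obtain g' where g': "(g has_derivative g') (at (f x))" "\<And>c v. g' (c *s v) = c *s g' v"
    using holomorphic_map_onE[OF assms(2), of "f x"] x assms(3) by blast
  show "\<exists>h. ((g \<circ> f) has_derivative h) (at x) \<and> (\<forall>c v. h (c *s v) = c *s h v)"
    by (rule exI[of _ "g' \<circ> f'"]) (use diff_chain_at[OF f'(1) g'(1)] f'(2) g'(2) in auto)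
qed

lemma holomorphic_map_on_imp_continuous_on: "holomorphic_map_on f S \<Longrightarrow> continuous_on S f"
  unfolding holomorphic_map_on_def
  by (meson continuous_at_imp_continuous_on has_derivative_continuous)

lemma norm_axis_complex: "norm (axis i x :: complex^'n::finite) = norm x"
proof -
  have "(\<Sum>j\<in>UNIV. (cmod (if j = i then x else 0))\<^sup>2) = (\<Sum>j\<in>UNIV. if j = i then (cmod x)\<^sup>2 else 0)"
    by (rule sum.cong) auto
  then show ?thesis by (simp add: norm_vec_def L2_set_def axis_def)
qed

lemma has_derivative_vec_lambda:
  fixes f :: "'n::finite \<Rightarrow> 'a::real_normed_vector \<Rightarrow> complex"
  assumes "\<And>i. (f i has_derivative f' i) F"
  shows "((\<lambda>x. \<chi> i. f i x) has_derivative (\<lambda>v. \<chi> i. f' i v)) F"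
proof -
  have ax: "bounded_linear (axis i :: complex \<Rightarrow> complex^'n)" for i :: 'n
    by (rule bounded_linear_intro[where K=1]) (simp_all add: norm_axis_complex, simp_all add: axis_def vec_eq_iff)
  have ex: "(\<chi> i. g i) = (\<Sum>i\<in>UNIV. axis i (g i))" for g :: "'n \<Rightarrow> complex"
    by (simp add: vec_eq_iff axis_def)
  show ?thesis unfolding ex
    by (intro has_derivative_sum bounded_linear.has_derivative[OF ax] assms)
qed

lemma norm_vec_mult: "norm (c *s x :: complex^'n::finite) = norm c * norm x"
  by (simp add: norm_vec_def norm_mult L2_set_right_distrib)

lemma bounded_linear_vec_mult: "bounded_linear (\<lambda>v. c *s (v :: complex^'n::finite))"
proof (rule bounded_linear_intro[where K="norm c"])
  fix x :: "complex^'n"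
  show "norm (c *s x) \<le> norm x * norm c"
    by (simp add: norm_vec_mult)
qed (auto simp: vec_eq_iff algebra_simps)

lemma bounded_linear_vec_mult_left: "bounded_linear (\<lambda>c. c *s (v :: complex^'n::finite))"
proof (rule bounded_linear_intro[where K="norm v"])
  fix c :: complex
  show "norm (c *s v) \<le> norm c * norm v"
    by (simp add: norm_vec_mult)
qed (auto simp: vec_eq_iff algebra_simps)

text \<open>Complex homogeneity of \<open>f'\<close> turns the real chain rule along the line into a
  complex derivative, with factor \<open>f' b $ i\<close>.\<close>

lemma holomorphic_map_on_affine_line:
  fixes f :: "complex^'n::finite \<Rightarrow> complex^'m::finite"
  assumes "(f has_derivative f') (at (a + z *s b))" "\<And>c v. f' (c *s v) = c *s f' v"
  shows "((\<lambda>\<zeta>. f (a + \<zeta> *s b) $ i) has_field_derivative f' b $ i) (at z)"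
proof -
  have "((\<lambda>\<zeta>. a + \<zeta> *s b) has_derivative (\<lambda>\<zeta>. \<zeta> *s b)) (at z)"
    using bounded_linear.has_derivative[OF bounded_linear_vec_mult_left, OF has_derivative_ident]
      has_derivative_const[of a] by (auto intro!: derivative_eq_intros)
  from diff_chain_at[OF this assms(1)]
  have "((\<lambda>\<zeta>. f (a + \<zeta> *s b)) has_derivative (\<lambda>\<zeta>. \<zeta> *s f' b)) (at z)"
    by (simp add: o_def assms(2))
  from bounded_linear.has_derivative[OF bounded_linear_vec_nth[of i] this]
  show ?thesis
    unfolding has_field_derivative_def
    by (rule has_derivative_eq_rhs) (simp add: fun_eq_iff)
qed

lemma holomorphic_on_line:
  fixes f :: "complex^'n::finite \<Rightarrow> complex^'m::finite"
  assumes "holomorphic_map_on f UNIV"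
  shows "(\<lambda>\<zeta>. f (a + \<zeta> *s b) $ i) holomorphic_on S"
proof -
  have "\<exists>d. ((\<lambda>\<zeta>. f (a + \<zeta> *s b) $ i) has_field_derivative d) (at z)" for z
  proof -
    obtain f' where "(f has_derivative f') (at (a + z *s b))" "\<And>c v. f' (c *s v) = c *s f' v"
      using holomorphic_map_onE[OF assms, of "a + z *s b"] by blast
    from holomorphic_map_on_affine_line[OF this] show ?thesis by blast
  qed
  then have "(\<lambda>\<zeta>. f (a + \<zeta> *s b) $ i) holomorphic_on UNIV"
    by (simp add: holomorphic_on_open)
  then show ?thesis by (rule holomorphic_on_subset) auto
qed

section \<open>Automorphisms, preimages of balls and vanishing of the Kobayashi metric\<close>

lemma holomorphic_automorphism_compose:
  assumes "holomorphic_automorphism f" "holomorphic_automorphism g"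
  shows "holomorphic_automorphism (g \<circ> f)"
  using assms unfolding holomorphic_automorphism_def
  by (auto simp: o_inv_distrib bij_comp intro: holomorphic_map_on_compose)

lemma holomorphic_automorphismI:
  assumes "\<And>x. g (f x) = x" "\<And>y. f (g y) = y" "holomorphic_map_on f UNIV" "holomorphic_map_on g UNIV"
  shows "holomorphic_automorphism f"
proof -
  have "bij f" by (rule o_bij[of g f]) (use assms in auto)
  moreover have "inv f = g" by (rule inv_unique_comp) (use assms in auto)
  ultimately show ?thesis using assms by (simp add: holomorphic_automorphism_def)
qed

text \<open>Rescaling by \<open>1/r\<close> makes the set the preimage of the unit ball under an
  automorphism, and that automorphism restricts to the required biholomorphic map. This supplies the
  exhaustion of a basin by balls.\<close>

lemma automorphism_preimage_ball:
  fixes g :: "complex^'n::finite \<Rightarrow> complex^'n"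
  assumes g: "holomorphic_automorphism g" and r: "r > 0"
  shows "biholomorphic {x. g x \<in> ball 0 r} (ball (0 :: complex^'n) 1)"
proof -
  define s where "s = (\<lambda>x::complex^'n. complex_of_real (1/r) *s x)"
  define s' where "s' = (\<lambda>x::complex^'n. complex_of_real r *s x)"
  have hol: "holomorphic_map_on (\<lambda>x::complex^'n. c *s x) UNIV" for c
    unfolding holomorphic_map_on_def
    by (intro ballI exI[of _ "\<lambda>x. c *s x"])
      (auto intro: bounded_linear_imp_has_derivative[OF bounded_linear_vec_mult] simp: vec_eq_iff)
  have "holomorphic_automorphism s"
    by (rule holomorphic_automorphismI[of s']) (use r hol in \<open>auto simp: s_def s'_def vec_eq_iff\<close>)
  then have a: "holomorphic_automorphism (s \<circ> g)"
    using g by (intro holomorphic_automorphism_compose)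
  let ?h = "s \<circ> g"
  have mem: "g x \<in> ball 0 r \<longleftrightarrow> ?h x \<in> ball 0 1" for x
    using r by (simp add: s_def norm_vec_mult norm_divide field_simps)
  from a have b: "bij ?h" and c: "continuous_on UNIV ?h" and d: "continuous_on UNIV (inv ?h)"
    by (auto simp: holomorphic_automorphism_def simp del: o_apply
        dest!: holomorphic_map_on_imp_continuous_on)
  have bl: "inv ?h (?h x) = x" "?h (inv ?h x) = x" for x
    using b by (simp_all add: bij_is_inj bij_is_surj surj_f_inv_f del: o_apply)
  have op: "open {x. ?h x \<in> ball 0 1}"
    using open_vimage[OF open_ball c, of 0 1] unfolding vimage_def .
  have "homeomorphism {x. ?h x \<in> ball 0 1} (ball 0 1) ?h (inv ?h)"
    by (rule homeomorphismI)
      (use bl in \<open>auto simp del: o_apply intro: continuous_on_subset[OF c] continuous_on_subset[OF d]\<close>)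
  with a op show ?thesis
    unfolding biholomorphic_def mem holomorphic_automorphism_def
    by (blast intro: holomorphic_map_on_subset)
qed

text \<open>The discs are the preimages under \<open>g\<close> of affine discs of radius \<open>r\<close>.\<close>

lemma kobayashi_metric_eq_0:
  fixes \<Omega> :: "(complex^'n::finite) set"
  assumes r: "r > 0"
    and ex: "\<And>e. e > 0 \<Longrightarrow> \<exists>g g'. holomorphic_automorphism g \<and> {x. g x \<in> ball 0 (2 * r)} \<subseteq> \<Omega> \<and>
               norm (g z) \<le> r \<and> (g has_derivative g') (at z) \<and> norm (g' v) < e"
  shows "kobayashi_metric \<Omega> z v = 0"
proof -
  let ?S = "{cmod \<alpha> | \<alpha>. \<exists>\<psi>. holomorphic_disc_in \<psi> \<Omega> \<and> \<psi> 0 = z \<and>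
                        \<alpha> *s (\<chi> i. deriv (\<lambda>\<zeta>. \<psi> \<zeta> $ i) 0) = v}"
  have *: "\<exists>s\<in>?S. s \<le> e" if e0: "e > 0" for e
  proof -
    obtain g g' where g: "holomorphic_automorphism g" "{x. g x \<in> ball 0 (2 * r)} \<subseteq> \<Omega>"
      "norm (g z) \<le> r" "(g has_derivative g') (at z)" "norm (g' v) < e * r"
      using ex[OF mult_pos_pos[OF e0 r]] by blast
    \<comment> \<open>This direction is sent to \<open>v / e\<close> by the derivative of
      \<open>inv g\<close>, so the disc \<open>\<psi>\<close> has derivative \<open>v / e\<close> at
      \<open>0\<close> and \<open>\<alpha> = e\<close> is admissible. The bound \<open>e * r\<close>
      gives \<open>norm b \<le> r\<close>, which keeps the affine disc around \<open>g z\<close>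
      inside the ball of radius \<open>2 * r\<close>.\<close>
    define b where "b = complex_of_real (1/e) *s g' v"
    define \<psi> where "\<psi> = (\<lambda>\<zeta>. inv g (g z + \<zeta> *s b))"
    have nb: "norm b \<le> r"
      using g(5) e0 by (simp add: b_def norm_vec_mult norm_divide field_simps)
    have bij: "bij g" and hol: "holomorphic_map_on (inv g) UNIV"
      using g(1) by (auto simp: holomorphic_automorphism_def)
    have inv: "inv g (g x) = x" "g (inv g x) = x" for x
      using bij by (simp_all add: bij_is_inj bij_is_surj surj_f_inv_f)
    obtain h where h: "(inv g has_derivative h) (at (g z))" "\<And>c v. h (c *s v) = c *s h v"
      using holomorphic_map_onE[OF hol, of "g z"] by blast
    have "h \<circ> g' = id"
      using has_derivative_unique[OF diff_chain_at[OF g(4) h(1)], of id] inv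
      by (simp add: o_def id_def)
    then have hb: "h b = complex_of_real (1/e) *s v"
      by (simp add: b_def h(2) o_def id_def fun_eq_iff)
    have d: "deriv (\<lambda>\<zeta>. \<psi> \<zeta> $ i) 0 = h b $ i" for i
      unfolding \<psi>_def
      by (rule DERIV_imp_deriv, rule holomorphic_map_on_affine_line[where f'=h]) (use h in auto)
    have "\<psi> \<zeta> \<in> \<Omega>" if "\<zeta> \<in> ball 0 1" for \<zeta>
    proof -
      have "norm (g z + \<zeta> *s b) \<le> norm (g z) + cmod \<zeta> * norm b"
        by (metis norm_triangle_ineq norm_vec_mult)
      also have "cmod \<zeta> * norm b \<le> cmod \<zeta> * r" by (intro mult_left_mono nb) auto
      also have "\<dots> < r" using that r by simp
      finally have "norm (g (\<psi> \<zeta>)) < 2 * r" using g(3) by (simp add: \<psi>_def inv)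
      then show ?thesis using g(2) by auto
    qed
    then have disc: "holomorphic_disc_in \<psi> \<Omega>"
      unfolding holomorphic_disc_in_def \<psi>_def using holomorphic_on_line[OF hol] by auto
    have "e \<in> ?S"
      by (rule CollectI, rule exI[of _ "complex_of_real e"], rule conjI, use e0 in simp)
        (rule exI[of _ \<psi>], use disc e0 in \<open>simp add: d hb vec_eq_iff\<close>, simp add: \<psi>_def inv)
    then show ?thesis by auto
  qed
  have bdd: "bdd_below ?S" by (rule bdd_belowI[of _ 0]) auto
  have le: "Inf ?S \<le> e" if "e > 0" for e
    using *[OF that] bdd by (meson cInf_lower2)
  have "0 \<le> Inf ?S"
    using *[of 1] by (intro cInf_greatest) auto
  moreover have "Inf ?S \<le> 0"
    by (rule field_le_epsilon) (simp only: add_0_left le)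
  ultimately have "Inf ?S = 0" by (rule order_antisym[rotated])
  then show ?thesis unfolding kobayashi_metric_def .
qed

section \<open>Subharmonicity of the logarithm of a norm\<close>

text \<open>Each cell of length \<open>2 * pi / N\<close> contains its sample point, so the sampled
  value minus \<open>e\<close> is at most \<open>f\<close> on the whole cell; integrating over the
  cells and adding gives the bound. The common offset \<open>t\<close> of the sample points is free
  because it will depend on a boundary point in the maximum principle.\<close>

lemma riemann_sum_le:
  fixes f :: "real \<Rightarrow> real" and N :: nat
  assumes N: "N > 0" and int: "f integrable_on {0..2 * pi}"
    and t: "0 \<le> t" "t \<le> 2 * pi / N"
    and osc: "\<And>x y. x \<in> {0..2 * pi} \<Longrightarrow> y \<in> {0..2 * pi} \<Longrightarrow> \<bar>x - y\<bar> \<le> 2 * pi / N \<Longrightarrow> f x \<le> f y + e"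
  shows "(\<Sum>k<N. f (t + 2 * pi * real k / real N)) \<le> N * (integral {0..2 * pi} f / (2 * pi) + e)"
proof -
  let ?h = "2 * pi / N"
  have h: "?h > 0" using N by simp
  have *: "(\<Sum>k<m. ?h * (f (t + ?h * real k) - e)) \<le> integral {0..?h * m} f" if "m \<le> N" for m
    using that
  proof (induction m)
    case (Suc m)
    have le: "?h * Suc m \<le> 2 * pi"
      using mult_left_mono[of "real (Suc m)" "real N" ?h] Suc.prems N by simp
    have mono: "0 \<le> ?h * m" "?h * m \<le> ?h * Suc m" using h by (simp_all add: distrib_left)
    have i2: "f integrable_on {?h * m..?h * Suc m}"
      by (rule integrable_on_subinterval[OF int]) (use le mono in auto)
    have s: "?h * Suc m = ?h * m + ?h" by (simp add: distrib_left)
    have "integral {?h * m..?h * Suc m} (\<lambda>_. f (t + ?h * m) - e) \<le> integral {?h * m..?h * Suc m} f"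
    proof (rule integral_le)
      fix y assume y: "y \<in> {?h * m..?h * Suc m}"
      from y have y': "?h * m \<le> y" "y \<le> ?h * Suc m" by (auto simp del: of_nat_Suc)
      have "f (t + ?h * m) \<le> f y + e"
        by (rule osc; unfold atLeastAtMost_iff abs_le_iff; intro conjI; use le mono t s y' in linarith)
      then show "f (t + ?h * m) - e \<le> f y" by simp
    qed (use i2 in auto)
    also have "integral {?h * m..?h * Suc m} (\<lambda>_. f (t + ?h * m) - e) = ?h * (f (t + ?h * m) - e)"
      using s by simp
    finally have "?h * (f (t + ?h * m) - e) \<le> integral {?h * m..?h * Suc m} f" .
    moreover have "integral {0..?h * m} f + integral {?h * m..?h * Suc m} f = integral {0..?h * Suc m} f"
      by (rule Henstock_Kurzweil_Integration.integral_combine) (use mono le in \<open>auto intro: integrable_on_subinterval[OF int]\<close>)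
    ultimately show ?case using Suc by simp
  qed simp
  have "?h * (\<Sum>k<N. f (t + ?h * real k) - e) \<le> integral {0..2 * pi} f"
    using *[of N] N by (simp add: sum_distrib_left)
  then have "(\<Sum>k<N. f (t + ?h * real k) - e) \<le> N * integral {0..2 * pi} f / (2 * pi)"
    using N by (simp add: field_simps)
  then show ?thesis by (simp add: sum_subtractf algebra_simps)
qed

text \<open>Zeros of \<open>g\<close> are handled by applying the maximum principle to the product of \<open>g (c + z\<zeta>)\<close>
  over all \<open>N\<close>-th roots of unity \<open>z\<close>: its logarithm on the circle is at most \<open>N\<close> times a Riemann sum
  of \<open>\<phi>\<close>.\<close>

lemma log_submean:
  fixes g :: "complex \<Rightarrow> complex" and \<phi> :: "complex \<Rightarrow> real"
  assumes r: "r > 0" and hol: "g holomorphic_on ball c r" and cont: "continuous_on (cball c r) g"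
    and \<phi>: "continuous_on (sphere c r) \<phi>"
    and le: "\<And>z. z \<in> sphere c r \<Longrightarrow> cmod (g z) \<le> exp (\<phi> z)"
  shows "cmod (g c) \<le> exp (integral {0..2 * pi} (\<lambda>\<theta>. \<phi> (c + of_real r * cis \<theta>)) / (2 * pi))"
proof -
  define f where "f = (\<lambda>\<theta>. \<phi> (c + of_real r * cis \<theta>))"
  define I where "I = integral {0..2 * pi} f / (2 * pi)"
  have fc: "continuous_on {0..2 * pi} f"
    unfolding f_def using r
    by (intro continuous_on_compose2[OF \<phi>] continuous_intros) (auto simp: dist_norm norm_mult)
  have bound: "cmod (g c) \<le> exp (I + e)" if e: "e > 0" for e
  proof -
    have "uniformly_continuous_on {0..2 * pi} f" using fc compact_uniformly_continuous by blast
    then obtain d where d: "d > 0"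
      "\<And>x y. x \<in> {0..2 * pi} \<Longrightarrow> y \<in> {0..2 * pi} \<Longrightarrow> dist x y < d \<Longrightarrow> dist (f x) (f y) < e"
      unfolding uniformly_continuous_on_def using e by (metis dist_commute)
    obtain N :: nat where N: "N > 2 * pi / d" "N > 0"
      by (metis reals_Archimedean2 gr0I less_trans divide_pos_pos d(1) pi_gt_zero
          zero_less_numeral mult_pos_pos of_nat_0 less_asym)
    have Nd: "2 * pi / N < d" using N d by (simp add: field_simps)
    define R where "R = {z::complex. z ^ N = 1}"
    have Rn: "cmod z = 1" if "z \<in> R" for z
      using that N unfolding R_def by (metis (mono_tags, lifting) mem_Collect_eq norm_one norm_power power_eq_1_iff norm_ge_zero not_gr0)
    have bR: "bij_betw (\<lambda>k. cis (2 * pi * real k / real N)) {..<N} R"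
      unfolding R_def using N by (intro Complex.bij_betw_roots_unity) auto
    define H where "H = (\<lambda>\<zeta>. \<Prod>z\<in>R. g (c + z * \<zeta>))"
    have mem: "c + z * \<zeta> \<in> cball c s \<longleftrightarrow> \<zeta> \<in> cball 0 s" "c + z * \<zeta> \<in> ball c s \<longleftrightarrow> \<zeta> \<in> ball 0 s"
      "c + z * \<zeta> \<in> sphere c s \<longleftrightarrow> \<zeta> \<in> sphere 0 s" if "z \<in> R" for z \<zeta> s
      using Rn[OF that] by (auto simp: dist_norm norm_mult)
    have "cmod (H 0) \<le> exp (I + e) ^ N"
    proof (rule maximum_modulus_frontier[of H "cball 0 r"])
      show "H holomorphic_on interior (cball 0 r)"
        unfolding H_def interior_cball
        by (intro holomorphic_on_prod holomorphic_on_compose_gen[OF _ hol, unfolded o_def] holomorphic_intros)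
          (use mem in auto)
      show "continuous_on (closure (cball 0 r)) H"
        unfolding H_def closure_closed[OF closed_cball]
        by (intro continuous_on_prod continuous_on_compose2[OF cont] continuous_intros)
          (use mem in auto)
      fix \<zeta> assume "\<zeta> \<in> frontier (cball (0::complex) r)"
      then have z: "\<zeta> \<in> sphere 0 r" using r by simp
      \<comment> \<open>The angle \<open>t = s / N\<close> lies in the first cell, and
        \<open>w\<close> has the same \<open>N\<close>-th power as \<open>\<zeta>\<close>. Hence
        \<open>\<zeta> / w\<close> is a root of unity, multiplication by it permutes
        \<open>R\<close>, and \<open>\<zeta>\<close> may be replaced by \<open>w\<close> in the
        product.\<close>
      define s where "s = Arg2pi (\<zeta> ^ N)"
      define t where "t = s / N"
      define w where "w = of_real r * cis t"
      have z0: "\<zeta> \<noteq> 0" "cmod \<zeta> = r" using z r by auto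
      have t: "0 \<le> t" "t \<le> 2 * pi / N"
        using Arg2pi_ge_0[of "\<zeta> ^ N"] Arg2pi_lt_2pi[of "\<zeta> ^ N"] N
        by (auto simp: t_def s_def divide_right_mono less_imp_le)
      have "\<zeta> ^ N = of_real (r ^ N) * cis s"
        using Arg2pi_eq[of "\<zeta> ^ N"] z0 by (simp add: s_def norm_power cis_conv_exp mult.commute)
      also have "\<dots> = w ^ N"
        using N by (simp add: w_def power_mult_distrib Complex.DeMoivre t_def)
      finally have wN: "\<zeta> ^ N = w ^ N" .
      have w0: "w \<noteq> 0" using r by (simp add: w_def)
      have bw: "bij_betw (\<lambda>z. z * (\<zeta> / w)) R R"
        by (rule bij_betw_byWitness[where f'="\<lambda>z. z * (w / \<zeta>)"])
          (use wN w0 z0 in \<open>auto simp: R_def power_mult_distrib power_divide\<close>)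
      have "H \<zeta> = (\<Prod>z\<in>R. g (c + z * (\<zeta> / w) * w))" using w0 by (simp add: H_def)
      also have "\<dots> = (\<Prod>z\<in>R. g (c + z * w))"
        by (rule prod.reindex_bij_betw[OF bw])
      also have "\<dots> = (\<Prod>k<N. g (c + cis (2 * pi * real k / real N) * w))"
        by (rule prod.reindex_bij_betw[OF bR, symmetric])
      finally have "cmod (H \<zeta>) = (\<Prod>k<N. cmod (g (c + cis (2 * pi * real k / real N) * w)))"
        by (simp add: prod_norm)
      also have "\<dots> \<le> (\<Prod>k<N. exp (f (t + 2 * pi * real k / real N)))"
      proof (intro prod_mono conjI)
        fix k assume "k \<in> {..<N}"
        have e: "cis (2 * pi * real k / real N) * w = of_real r * cis (t + 2 * pi * real k / real N)"
          by (simp add: w_def cis_mult add.commute)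
        show "cmod (g (c + cis (2 * pi * real k / real N) * w)) \<le> exp (f (t + 2 * pi * real k / real N))"
          unfolding f_def e by (rule le) (use r in \<open>simp add: dist_norm norm_mult\<close>)
      qed auto
      also have "\<dots> = exp (\<Sum>k<N. f (t + 2 * pi * real k / real N))" by (simp add: exp_sum)
      also have "(\<Sum>k<N. f (t + 2 * pi * real k / real N)) \<le> N * (I + e)"
        unfolding I_def
      proof (rule riemann_sum_le[OF N(2) integrable_continuous_real[OF fc] t])
        fix x y :: real assume "x \<in> {0..2 * pi}" "y \<in> {0..2 * pi}" "\<bar>x - y\<bar> \<le> 2 * pi / N"
        then show "f x \<le> f y + e" using d(2)[of x y] Nd by (simp add: dist_real_def)
      qed
      finally show "cmod (H \<zeta>) \<le> exp (I + e) ^ N" by (simp add: exp_of_nat_mult)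
    qed (use r in auto)
    moreover have "H 0 = g c ^ N"
      using bij_betw_same_card[OF bR] by (simp add: H_def)
    ultimately have "cmod (g c) ^ N \<le> exp (I + e) ^ N" by (simp add: norm_power)
    then show ?thesis using N by (simp add: power_mono_iff)
  qed
  have "((\<lambda>e. exp (I + e)) \<longlongrightarrow> exp (I + 0)) (at_right 0)" by (intro tendsto_intros)
  then have "cmod (g c) \<le> exp (I + 0)"
    by (rule tendsto_lowerbound) (use bound in \<open>auto simp: eventually_at_right_field intro!: exI[of _ 1]\<close>)
  then show ?thesis by (simp add: I_def f_def)
qed

text \<open>If \<open>norm (g c) \<le> \<delta>\<close>, the left side is
  \<open>ln \<delta>\<close>, a lower bound of the integrand. Otherwise pairing \<open>g\<close>
  with the fixed vector \<open>g c\<close> reduces the claim to \<open>log_submean\<close> for a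
  scalar function. The floor \<open>\<delta>\<close> keeps the logarithm continuous at zeros of
  \<open>g\<close>.\<close>

lemma log_norm_submean:
  fixes g :: "complex \<Rightarrow> complex^'n::finite"
  assumes hol: "\<And>i. (\<lambda>\<zeta>. g \<zeta> $ i) holomorphic_on UNIV" and \<delta>: "\<delta> > 0" and r: "r > 0"
  shows "ln (max (norm (g c)) \<delta>)
           \<le> integral {0..2 * pi} (\<lambda>\<theta>. ln (max (norm (g (c + of_real r * cis \<theta>))) \<delta>)) / (2 * pi)"
proof -
  define \<phi> where "\<phi> = (\<lambda>\<zeta>. ln (max (norm (g \<zeta>)) \<delta>))"
  define pt where "pt = (\<lambda>\<theta>. c + of_real r * cis \<theta>)"
  have g_cont: "continuous_on S g" for S
  proof -
    have "continuous_on S (\<lambda>\<zeta>. \<chi> i. g \<zeta> $ i)"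
      by (intro continuous_on_vec_lambda holomorphic_on_imp_continuous_on holomorphic_on_subset[OF hol]) auto
    then show ?thesis by simp
  qed
  have \<phi>_cont: "continuous_on S \<phi>" for S
    unfolding \<phi>_def using \<delta> by (intro continuous_intros g_cont) auto
  have pt_int: "(\<lambda>\<theta>. \<phi> (pt \<theta>)) integrable_on {0..2 * pi}"
    unfolding pt_def
    by (intro integrable_continuous_real continuous_on_compose2[OF \<phi>_cont[of UNIV]] continuous_intros) auto
  show ?thesis
  proof (cases "norm (g c) \<le> \<delta>")
    case True
    have "integral {0..2 * pi} (\<lambda>_. ln \<delta>) \<le> integral {0..2 * pi} (\<lambda>\<theta>. \<phi> (pt \<theta>))"
      by (rule integral_le) (use pt_int \<delta> in \<open>auto simp: \<phi>_def\<close>)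
    then show ?thesis using True by (simp add: \<phi>_def pt_def field_simps max_absorb2)
  next
    case False
    define A where "A = norm (g c)"
    have A: "A > 0" "A > \<delta>" using False \<delta> by (auto simp: A_def)
    \<comment> \<open>By Cauchy-Schwarz \<open>h\<close> is bounded by \<open>A * norm (g \<zeta>)\<close>, with equality at \<open>c\<close>.\<close>
    define h where "h = (\<lambda>\<zeta>. \<Sum>i\<in>UNIV. cnj (g c $ i) * g \<zeta> $ i)"
    have hh: "h holomorphic_on S" for S
      unfolding h_def by (intro holomorphic_intros holomorphic_on_subset[OF hol]) auto
    have "h c = of_real (A\<^sup>2)"
      by (simp add: h_def A_def norm_vec_def L2_set_def sum_nonneg complex_norm_square of_real_power[symmetric] mult.commute del: of_real_power)
    then have hc: "cmod (h c) = A * A" by (simp add: power2_eq_square norm_mult)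
    have "cmod (h \<zeta>) \<le> exp (ln A + \<phi> \<zeta>)" for \<zeta>
    proof -
      have "cmod (h \<zeta>) \<le> (\<Sum>i\<in>UNIV. \<bar>cmod (g c $ i)\<bar> * \<bar>cmod (g \<zeta> $ i)\<bar>)"
        unfolding h_def by (rule order_trans[OF norm_sum]) (simp add: norm_mult)
      also have "\<dots> \<le> A * norm (g \<zeta>)" unfolding A_def norm_vec_def by (rule L2_set_mult_ineq)
      also have "\<dots> \<le> A * max (norm (g \<zeta>)) \<delta>" using A by simp
      also have "\<dots> = exp (ln A + \<phi> \<zeta>)" using A \<delta> by (simp add: \<phi>_def exp_add)
      finally show ?thesis .
    qed
    then have "cmod (h c) \<le> exp (integral {0..2 * pi} (\<lambda>\<theta>. ln A + \<phi> (c + of_real r * cis \<theta>)) / (2 * pi))"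
      by (intro log_submean[OF r hh holomorphic_on_imp_continuous_on[OF hh]] continuous_intros \<phi>_cont)
    also have "integral {0..2 * pi} (\<lambda>\<theta>. ln A + \<phi> (c + of_real r * cis \<theta>)) / (2 * pi)
        = ln A + integral {0..2 * pi} (\<lambda>\<theta>. \<phi> (pt \<theta>)) / (2 * pi)"
      using integral_unique[OF has_integral_add[OF has_integral_const_real[of "ln A"] integrable_integral[OF pt_int]]]
      unfolding pt_def by (simp add: add_divide_distrib)
    finally have "A \<le> exp (integral {0..2 * pi} (\<lambda>\<theta>. \<phi> (pt \<theta>)) / (2 * pi))"
      using A by (simp add: hc exp_add)
    then have "ln A \<le> integral {0..2 * pi} (\<lambda>\<theta>. \<phi> (pt \<theta>)) / (2 * pi)"
      using A by (metis exp_le_cancel_iff exp_ln)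
    then show ?thesis using A by (simp add: A_def \<phi>_def pt_def)
  qed
qed

text \<open>Monotone convergence, applied to \<open>- w n\<close>, which increases to
  \<open>- u\<close>. Since \<open>u \<le> 0\<close> on the circle, the integral of the positive
  part in \<open>circle_mean\<close> vanishes and only the negative part has to be computed.\<close>

lemma le_circle_mean_INF:
  fixes w :: "nat \<Rightarrow> complex \<Rightarrow> real"
  assumes r: "r > 0" and cont: "\<And>n. continuous_on (sphere c r) (w n)"
    and nonpos: "\<And>n z. z \<in> sphere c r \<Longrightarrow> w n z \<le> 0"
    and dec: "\<And>n z. z \<in> sphere c r \<Longrightarrow> w (Suc n) z \<le> w n z"
    and u: "\<And>z. z \<in> sphere c r \<Longrightarrow> u z = (INF n. ereal (w n z))"
    and le: "\<And>n. A \<le> ereal (integral {0..2 * pi} (\<lambda>\<theta>. w n (c + of_real r * cis \<theta>)) / (2 * pi))"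
  shows "A \<le> circle_mean u c r"
proof -
  define pt where "pt = (\<lambda>\<theta>. c + of_real r * cis \<theta>)"
  have pt: "pt \<theta> \<in> sphere c r" for \<theta>
    using r by (simp add: pt_def dist_norm norm_mult)
  define v where "v = (\<lambda>n \<theta>. - w n (pt \<theta>))"
  have v_cont: "continuous_on {0..2 * pi} (v n)" for n
    unfolding v_def pt_def using r
    by (intro continuous_intros continuous_on_compose2[OF cont]) (auto simp: dist_norm norm_mult)
  have v0: "0 \<le> v n \<theta>" for n \<theta> using nonpos[OF pt] by (simp add: v_def)
  have u0: "u (pt \<theta>) \<le> 0" for \<theta>
    unfolding u[OF pt] by (rule INF_lower2[of 0]) (use nonpos[OF pt] in auto)
  have minus_u: "e2ennreal (- u (pt \<theta>)) = (SUP n. ennreal (v n \<theta>))" for \<theta>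
  proof -
    have "- u (pt \<theta>) = (SUP n. ereal (v n \<theta>))"
      unfolding u[OF pt] using ereal_SUP_uminus_eq[of "\<lambda>n. ereal (w n (pt \<theta>))" UNIV] by (simp add: v_def)
    \<comment> \<open>The conversion is monotone and continuous, hence commutes with the
      supremum.\<close>
    moreover have "e2ennreal (SUP n. ereal (v n \<theta>)) = (SUP n. e2ennreal (ereal (v n \<theta>)))"
      using continuous_at_Sup_mono[of e2ennreal "range (\<lambda>n. ereal (v n \<theta>))"]
      by (simp add: monoI e2ennreal_mono continuous_at_e2ennreal image_comp)
    ultimately show ?thesis by simp
  qed
  have v_int: "(\<integral>\<^sup>+\<theta>\<in>{0..2 * pi}. ennreal (v n \<theta>) \<partial>lborel) = ennreal (integral {0..2 * pi} (v n))" for n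
  proof -
    have i: "set_integrable lborel {0..2 * pi} (v n)"
      by (rule borel_integrable_atLeastAtMost'[OF v_cont])
    have "(\<integral>\<^sup>+\<theta>. ennreal (indicator {0..2 * pi} \<theta> *\<^sub>R v n \<theta>) \<partial>lborel)
        = ennreal (\<integral>\<theta>. indicator {0..2 * pi} \<theta> *\<^sub>R v n \<theta> \<partial>lborel)"
      by (rule nn_integral_eq_integral) (use i v0 in \<open>auto simp: set_integrable_def\<close>)
    then show ?thesis
      using set_borel_integral_eq_integral(2)[OF i]
      by (simp add: set_lebesgue_integral_def nn_integral_set_ennreal mult.commute)
  qed
  have "(\<integral>\<^sup>+\<theta>\<in>{0..2 * pi}. e2ennreal (- u (pt \<theta>)) \<partial>lborel)
      = (\<integral>\<^sup>+\<theta>. (SUP n. ennreal (v n \<theta>) * indicator {0..2 * pi} \<theta>) \<partial>lborel)"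
    by (simp add: minus_u SUP_mult_right_ennreal)
  also have "\<dots> = (SUP n. \<integral>\<^sup>+\<theta>\<in>{0..2 * pi}. ennreal (v n \<theta>) \<partial>lborel)"
  proof (rule nn_integral_monotone_convergence_SUP)
    show "incseq (\<lambda>n \<theta>. ennreal (v n \<theta>) * indicator {0..2 * pi} \<theta>)"
      by (intro incseq_SucI le_funI mult_right_mono ennreal_leI)
        (use dec[OF pt] in \<open>auto simp: v_def\<close>)
    fix n
    have "(\<lambda>\<theta>. indicator {0..2 * pi} \<theta> *\<^sub>R v n \<theta>) \<in> borel_measurable borel"
      by (rule borel_measurable_continuous_on_indicator[OF _ v_cont]) simp
    then have "(\<lambda>\<theta>. ennreal (indicator {0..2 * pi} \<theta> * v n \<theta>)) \<in> borel_measurable borel"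
      by simp
    then show "(\<lambda>\<theta>. ennreal (v n \<theta>) * indicator {0..2 * pi} \<theta>) \<in> borel_measurable lborel"
      by (simp add: v0 ennreal_mult'' mult.commute flip: ennreal_indicator)
  qed
  finally have J: "(\<integral>\<^sup>+\<theta>\<in>{0..2 * pi}. e2ennreal (- u (pt \<theta>)) \<partial>lborel)
      = (SUP n. ennreal (integral {0..2 * pi} (v n)))" by (simp add: v_int)
  have cm: "circle_mean u c r = - enn2ereal (SUP n. ennreal (integral {0..2 * pi} (v n))) / ereal (2 * pi)"
    unfolding circle_mean_def J[unfolded pt_def] by (simp add: e2ennreal_neg u0[unfolded pt_def] zero_ennreal.rep_eq)
  \<comment> \<open>For a real \<open>A = a\<close> all integrals of \<open>v n\<close> are at most
    \<open>- (2 * pi * a)\<close>, so their supremum is finite and the division can be done in the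
    reals. The value \<open>-\<infinity>\<close> is trivial, and \<open>\<infinity>\<close>
    contradicts the assumed bound.\<close>
  show ?thesis
  proof (cases A)
    case (real a)
    have "integral {0..2 * pi} (v n) \<le> - (2 * pi * a)" for n
      using le[of n] real by (simp add: v_def pt_def field_simps)
    then have "(SUP n. ennreal (integral {0..2 * pi} (v n))) \<le> ennreal (- (2 * pi * a))"
      by (intro SUP_least ennreal_leI) auto
    moreover have "- (2 * pi * a) \<ge> 0"
      using le[of 0] real integral_nonneg[OF integrable_continuous_real[OF v_cont[of 0]] v0]
      by (simp add: v_def pt_def field_simps mult_nonneg_nonpos)
    ultimately obtain j where j: "j \<ge> 0" "(SUP n. ennreal (integral {0..2 * pi} (v n))) = ennreal j"
      "j \<le> - (2 * pi * a)"
      by (cases "(SUP n. ennreal (integral {0..2 * pi} (v n)))") (auto simp: top_unique)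
    show ?thesis unfolding cm j(2) using j(1,3) by (simp add: real field_simps)
  qed (use le[of 0] in auto)
qed

text \<open>An infimum is below \<open>c\<close> exactly when one of its terms is, so the sublevel
  set is a union of open sets, even though the index set varies with the point. The map
  \<open>L\<close> will be the identity or a complex line.\<close>

lemma upper_semicontinuous_on_compose_INF:
  fixes h :: "nat \<Rightarrow> 'a::topological_space \<Rightarrow> real"
  assumes op: "\<And>n. open (W n)" and cont: "\<And>n. continuous_on UNIV (h n)" and L: "continuous_on UNIV L"
  shows "upper_semicontinuous_on {\<zeta>. L \<zeta> \<in> (\<Union>n. W n)} (\<lambda>\<zeta>. INF n\<in>{n. L \<zeta> \<in> W n}. ereal (h n (L \<zeta>)))"
  unfolding upper_semicontinuous_on_def
proof
  fix c
  let ?S = "\<Union>n. {\<zeta>. L \<zeta> \<in> W n} \<inter> {\<zeta>. ereal (h n (L \<zeta>)) < c}"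
  have "open ?S"
  proof (intro open_UN ballI open_Int)
    fix n
    show "open {\<zeta>. L \<zeta> \<in> W n}" using open_vimage[OF op L] by (simp add: vimage_def)
    show "open {\<zeta>. ereal (h n (L \<zeta>)) < c}"
      by (intro open_Collect_less continuous_intros continuous_on_compose2[OF cont L]) auto
  qed
  moreover have "{\<zeta> \<in> {\<zeta>. L \<zeta> \<in> (\<Union>n. W n)}. (INF n\<in>{n. L \<zeta> \<in> W n}. ereal (h n (L \<zeta>))) < c} = ?S"
    by (auto simp: INF_less_iff)
  ultimately show "openin (top_of_set {\<zeta>. L \<zeta> \<in> (\<Union>n. W n)})
      {\<zeta> \<in> {\<zeta>. L \<zeta> \<in> (\<Union>n. W n)}. (INF n\<in>{n. L \<zeta> \<in> W n}. ereal (h n (L \<zeta>))) < c}"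
    by (auto intro: open_subset)
qed

section \<open>Basins of superattracting sequences\<close>

text \<open>\<open>F_half\<close> and \<open>F_deriv\<close> make orbits and derivatives tend to
  \<open>0\<close>; \<open>F_quad\<close> and the growth condition on \<open>\<delta>\<close> make
  the approximations of the Green function decrease; \<open>\<delta>_decay\<close> makes their limit
  \<open>-\<infinity>\<close> over the origin. The start \<open>G 0\<close> may be any automorphism,
  so that a change of coordinates can be built in.\<close>

locale superattracting_basin =
  fixes F G :: "nat \<Rightarrow> complex^'n::finite \<Rightarrow> complex^'n" and r :: real and \<delta> :: "nat \<Rightarrow> real"
  assumes G_aut: "\<And>n. holomorphic_automorphism (G n)"
    and G_Suc: "\<And>n x. G (Suc n) x = F n (G n x)"
    and r: "0 < r" "r < 1/2"
    and F_deriv: "\<And>n x. norm x < r \<Longrightarrow>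
          \<exists>F'. (F n has_derivative F') (at x) \<and> (\<forall>v. norm (F' v) \<le> norm v / 2)"
    and F_half: "\<And>n x. norm x < r \<Longrightarrow> norm (F n x) \<le> norm x / 2"
    and F_quad: "\<And>n x. norm x < r \<Longrightarrow> norm (F n x) \<le> (norm x)\<^sup>2 + \<delta> n * norm x"
    and \<delta>: "\<And>n. 0 < \<delta> n" "\<And>n. \<delta> n < 1/2" "\<And>n. \<delta> (Suc n) \<le> 2 * (\<delta> n)\<^sup>2"
    and \<delta>_decay: "\<And>M. \<exists>n. ln (2 * \<delta> n) < M * 2 ^ n"
begin

section \<open>The basin and its Green function\<close>

definition basin :: "(complex^'n) set" where
  "basin = (\<Union>n. {x. G n x \<in> ball 0 r})"

text \<open>The summand \<open>ln 2\<close> is the normalisation for which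
  \<open>y \<mapsto> 2 * y\<^sup>2\<close> exactly doubles \<open>ln 2 + ln y\<close>; the floor
  \<open>\<delta> n\<close> keeps the function real and continuous.\<close>

definition green_approx :: "nat \<Rightarrow> complex^'n \<Rightarrow> real" where
  "green_approx n x = (ln 2 + ln (max (norm (G n x)) (\<delta> n))) / 2 ^ n"

text \<open>The infimum runs only over times at which the orbit is already in the ball, where the
  approximations decrease. These times are given by open conditions, which yields upper
  semicontinuity.\<close>

definition green :: "complex^'n \<Rightarrow> ereal" where
  "green x = (INF n\<in>{n. x \<in> {x. G n x \<in> ball 0 r}}. ereal (green_approx n x))"

lemma G_continuous: "continuous_on S (G n)"
  using G_aut[of n] holomorphic_map_on_imp_continuous_on[of "G n" UNIV]
  by (auto simp: holomorphic_automorphism_def intro: continuous_on_subset)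

lemma orbit_norm_le: "norm (G n x) < r \<Longrightarrow> norm (G (n + m) x) \<le> norm (G n x) / 2 ^ m"
proof (induction m)
  case (Suc m)
  then have "norm (G (n + m) x) < r"
    by (smt (verit) divide_le_eq_1 one_le_power mult_le_cancel_left1 divide_le_eq norm_ge_zero zero_less_power)
  then have "norm (G (n + Suc m) x) \<le> norm (G (n + m) x) / 2"
    using F_half[of "G (n + m) x" "n + m"] by (simp add: G_Suc)
  also have "\<dots> \<le> norm (G n x) / 2 ^ m / 2" using Suc by (intro divide_right_mono) auto
  finally show ?case by (simp add: mult.commute)
qed simp

lemma orbit_stays: "norm (G n x) < r \<Longrightarrow> n \<le> m \<Longrightarrow> norm (G m x) < r"
proof -
  assume a: "norm (G n x) < r" "n \<le> m"
  have "norm (G n x) / 2 ^ (m - n) \<le> norm (G n x) / 1"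
    by (intro divide_left_mono) auto
  then show ?thesis using orbit_norm_le[OF a(1), of "m - n"] a by simp
qed

lemma orbit_tendsto_0: "norm (G n x) < r \<Longrightarrow> (\<lambda>m. G m x) \<longlonglongrightarrow> 0"
proof -
  assume a: "norm (G n x) < r"
  have "(\<lambda>m. norm (G n x) * (1/2) ^ m) \<longlonglongrightarrow> norm (G n x) * 0"
    by (intro tendsto_intros LIMSEQ_realpow_zero) auto
  then have lim: "(\<lambda>m. norm (G n x) * (1/2) ^ m) \<longlonglongrightarrow> 0" by simp
  have "norm (G (m + n) x) \<le> norm (G n x) * (1/2) ^ m" for m
    using orbit_norm_le[OF a, of m] by (simp add: add.commute[of m] power_divide)
  then have "(\<lambda>m. G (m + n) x) \<longlonglongrightarrow> 0"
    by (intro Lim_null_comparison[OF always_eventually lim] allI)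
  then show ?thesis by (rule LIMSEQ_offset)
qed

lemma green_approx_nonpos: "norm (G n x) < r \<Longrightarrow> green_approx n x \<le> 0"
proof -
  assume "norm (G n x) < r"
  then have "max (norm (G n x)) (\<delta> n) \<le> 1/2" using r \<delta>(2)[of n] by simp
  then have "ln (max (norm (G n x)) (\<delta> n)) \<le> ln (1/2)" using \<delta>(1)[of n] by (intro ln_mono) auto
  then show ?thesis by (simp add: green_approx_def ln_div field_simps)
qed

text \<open>With \<open>y = max (norm (G n x)) (\<delta> n)\<close>, both
  \<open>norm (G (Suc n) x)\<close> and \<open>\<delta> (Suc n)\<close> are at most
  \<open>2 * y\<^sup>2\<close>. The resulting doubling of \<open>ln 2 + ln y\<close> is cancelled by
  the denominator \<open>2 ^ Suc n\<close>.\<close>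

lemma green_approx_Suc: "norm (G n x) < r \<Longrightarrow> green_approx (Suc n) x \<le> green_approx n x"
proof -
  assume a: "norm (G n x) < r"
  define y where "y = max (norm (G n x)) (\<delta> n)"
  have y: "y > 0" "norm (G n x) \<le> y" "\<delta> n \<le> y" using \<delta>(1)[of n] by (auto simp: y_def)
  have "norm (F n (G n x)) \<le> (norm (G n x))\<^sup>2 + \<delta> n * norm (G n x)" by (rule F_quad[OF a])
  also have "\<dots> \<le> y\<^sup>2 + y * y" using y \<delta>(1)[of n] by (intro add_mono power_mono mult_mono) auto
  finally have "norm (G (Suc n) x) \<le> 2 * y\<^sup>2" by (simp add: G_Suc power2_eq_square)
  moreover have "\<delta> (Suc n) \<le> 2 * y\<^sup>2"
    using \<delta>(3)[of n] power_mono[OF y(3), of 2] \<delta>(1)[of n] by simp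
  ultimately have "ln (max (norm (G (Suc n) x)) (\<delta> (Suc n))) \<le> ln (2 * y\<^sup>2)"
    using \<delta>(1)[of "Suc n"] y by (intro ln_mono) auto
  also have "\<dots> = ln 2 + 2 * ln y" using y by (simp add: ln_mult ln_realpow)
  finally have "(ln 2 + ln (max (norm (G (Suc n) x)) (\<delta> (Suc n)))) / 2 ^ Suc n \<le> 2 * (ln 2 + ln y) / 2 ^ Suc n"
    by (intro divide_right_mono) auto
  also have "\<dots> = (ln 2 + ln y) / 2 ^ n" by (simp only: power_Suc mult_divide_mult_cancel_left_if) simp
  finally show ?thesis by (simp add: green_approx_def y_def)
qed

text \<open>The approximations decrease from any time of entry on, so every term of the infimum is
  undercut by a later one and the infimum may start at any \<open>N\<close> in the ball. This
  exhibits \<open>green\<close> as the limit of a decreasing sequence.\<close>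

lemma green_eq:
  assumes "norm (G N x) < r"
  shows "green x = (INF n. ereal (green_approx (N + n) x))"
  unfolding green_def
proof (rule INF_eq)
  fix m assume "m \<in> {n. x \<in> {x. G n x \<in> ball 0 r}}"
  then have m: "norm (G m x) < r" by simp
  have "green_approx (m + k) x \<le> green_approx m x" for k
  proof (induction k)
    case (Suc k)
    with green_approx_Suc[OF orbit_stays[OF m, of "m + k"]] show ?case by simp
  qed simp
  from this[of N] show "\<exists>k\<in>UNIV. ereal (green_approx (N + k) x) \<le> ereal (green_approx m x)"
    by (auto simp: add.commute intro!: exI[of _ m])
next
  fix j
  have "norm (G (N + j) x) < r" by (rule orbit_stays[OF assms]) simp
  then show "\<exists>i\<in>{n. x \<in> {x. G n x \<in> ball 0 r}}. ereal (green_approx i x) \<le> ereal (green_approx (N + j) x)"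
    by (intro bexI[of _ "N + j"]) auto
qed

lemma green_nonpos: "x \<in> basin \<Longrightarrow> green x \<le> 0"
  unfolding basin_def
  by (auto simp: green_eq intro!: INF_lower2[of 0] green_approx_nonpos)

lemma green_approx_continuous: "continuous_on S (green_approx n)"
  unfolding green_approx_def using \<delta>(1)[of n]
  by (intro continuous_intros G_continuous) (auto simp: max_def)

lemma open_levels: "open {x. G n x \<in> ball 0 r}"
  using open_vimage[OF open_ball G_continuous[of UNIV n], of 0 r] unfolding vimage_def .

lemma levels_mono: "n \<le> m \<Longrightarrow> {x. G n x \<in> ball 0 r} \<subseteq> {x. G m x \<in> ball 0 r}"
  using orbit_stays by auto

text \<open>From a time \<open>N\<close> common to the whole closed disc, \<open>green\<close> is a
  decreasing limit of the functions \<open>green_approx (N + n)\<close>. Each of these satisfies the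
  mean value inequality by \<open>log_norm_submean\<close>, and \<open>le_circle_mean_INF\<close>
  passes to the limit.\<close>

lemma green_submean:
  fixes a b :: "complex^'n"
  assumes s: "s > 0" and sub: "cball c s \<subseteq> {\<zeta>. a + \<zeta> *s b \<in> basin}"
  shows "green (a + c *s b) \<le> circle_mean (\<lambda>\<zeta>. green (a + \<zeta> *s b)) c s"
proof -
  define L where "L = (\<lambda>\<zeta>. a + \<zeta> *s b)"
  have L: "continuous_on S L" for S
    unfolding L_def by (intro continuous_intros bounded_linear.continuous_on[OF bounded_linear_vec_mult_left])
  define W where "W = (\<lambda>n. {\<zeta>. L \<zeta> \<in> {x. G n x \<in> ball 0 r}})"
  have cov: "cball c s \<subseteq> (\<Union>n\<in>UNIV. W n)"
    using sub by (auto simp: L_def basin_def W_def)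
  have "open (W n)" for n
    using open_vimage[OF open_levels[of n] L] unfolding vimage_def W_def .
  \<comment> \<open>Compactness turns the pointwise entry times into finitely many; since orbits
    never leave the ball again, their maximum serves every point of the disc.\<close>
  then obtain D where D: "finite D" "cball c s \<subseteq> (\<Union>n\<in>D. W n)"
    using compactE_image[OF compact_cball _ cov] by metis
  define N where "N = Max D"
  have N: "norm (G N (L \<zeta>)) < r" if "\<zeta> \<in> cball c s" for \<zeta>
  proof -
    obtain n where "n \<in> D" "norm (G n (L \<zeta>)) < r" using D(2) \<open>\<zeta> \<in> cball c s\<close> unfolding W_def by auto
    then show ?thesis using orbit_stays[of n "L \<zeta>" N] D(1) by (simp add: N_def)
  qed
  have c: "c \<in> cball c s" using s by simp
  have Nn: "norm (G (N + n) (L \<zeta>)) < r" if "\<zeta> \<in> cball c s" for n \<zeta>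
    using orbit_stays[OF N[OF that]] by simp
  have "green (L c) \<le> circle_mean (\<lambda>\<zeta>. green (L \<zeta>)) c s"
  proof (rule le_circle_mean_INF[OF s, where w="\<lambda>n \<zeta>. green_approx (N + n) (L \<zeta>)"])
    fix n
    show "continuous_on (sphere c s) (\<lambda>\<zeta>. green_approx (N + n) (L \<zeta>))"
      by (rule continuous_on_compose2[OF green_approx_continuous[of UNIV] L]) auto
    define \<psi> where "\<psi> = (\<lambda>\<theta>. ln (max (norm (G (N + n) (L (c + of_real s * cis \<theta>)))) (\<delta> (N + n))))"
    have \<psi>i: "\<psi> integrable_on {0..2 * pi}"
      unfolding \<psi>_def using \<delta>(1)[of "N + n"]
      by (intro integrable_continuous_real continuous_intros continuous_on_compose2[OF G_continuous[of UNIV]]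
          continuous_on_compose2[OF L[of UNIV]]) (auto simp: max_def)
    have "ln (max (norm (G (N + n) (L c))) (\<delta> (N + n))) \<le> integral {0..2 * pi} \<psi> / (2 * pi)"
      unfolding \<psi>_def
      by (rule log_norm_submean[OF _ \<delta>(1) s], unfold L_def, rule holomorphic_on_line)
        (use G_aut in \<open>auto simp: holomorphic_automorphism_def\<close>)
    then have "green_approx (N + n) (L c) \<le> (ln 2 + integral {0..2 * pi} \<psi> / (2 * pi)) / 2 ^ (N + n)"
      unfolding green_approx_def by (intro divide_right_mono add_left_mono) auto
    moreover have "integral {0..2 * pi} (\<lambda>\<theta>. ln 2 + \<psi> \<theta>) = 2 * pi * ln 2 + integral {0..2 * pi} \<psi>"
      using integral_unique[OF has_integral_add[OF has_integral_const_real[of "ln 2"] integrable_integral[OF \<psi>i]]]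
      by simp
    then have "(ln 2 + integral {0..2 * pi} \<psi> / (2 * pi)) / 2 ^ (N + n)
        = integral {0..2 * pi} (\<lambda>\<theta>. (ln 2 + \<psi> \<theta>) / 2 ^ (N + n)) / (2 * pi)"
      by (simp add: field_simps)
    ultimately have le: "green_approx (N + n) (L c)
        \<le> integral {0..2 * pi} (\<lambda>\<theta>. green_approx (N + n) (L (c + of_real s * cis \<theta>))) / (2 * pi)"
      by (simp add: green_approx_def \<psi>_def)
    have "green (L c) \<le> ereal (green_approx (N + n) (L c))"
      unfolding green_eq[OF N[OF c]] by (rule INF_lower) auto
    also note ereal_less_eq(3)[THEN iffD2, OF le]
    finally show "green (L c) \<le> ereal (integral {0..2 * pi}
        (\<lambda>\<theta>. green_approx (N + n) (L (c + of_real s * cis \<theta>))) / (2 * pi))"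
      .
  next
    fix n z assume "z \<in> sphere c s"
    then have z: "z \<in> cball c s" by simp
    show "green_approx (N + n) (L z) \<le> 0" by (rule green_approx_nonpos[OF Nn[OF z]])
    show "green_approx (N + Suc n) (L z) \<le> green_approx (N + n) (L z)"
      using green_approx_Suc[OF Nn[OF z]] by simp
    show "green (L z) = (INF n. ereal (green_approx (N + n) (L z)))" by (rule green_eq[OF N[OF z]])
  qed
  then show ?thesis by (simp add: L_def)
qed

lemma green_psh: "plurisubharmonic_on basin green"
proof -
  have usc: "upper_semicontinuous_on {\<zeta>. L \<zeta> \<in> basin} (\<lambda>\<zeta>. green (L \<zeta>))"
    if "continuous_on UNIV L" for L :: "'b::topological_space \<Rightarrow> complex^'n"
    unfolding green_def basin_def
    by (rule upper_semicontinuous_on_compose_INF[OF open_levels green_approx_continuous that])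
  have "continuous_on UNIV (\<lambda>\<zeta>. a + \<zeta> *s b)" for a b :: "complex^'n"
    by (intro continuous_intros bounded_linear.continuous_on[OF bounded_linear_vec_mult_left])
  moreover have finite: "green x < \<infinity>" if "x \<in> basin" for x
    using green_nonpos[OF that] by (rule le_less_trans) simp
  ultimately have "subharmonic_on {\<zeta>. a + \<zeta> *s b \<in> basin} (\<lambda>\<zeta>. green (a + \<zeta> *s b))" for a b
    unfolding subharmonic_on_def by (intro conjI ballI allI impI usc green_submean) simp_all
  moreover have "upper_semicontinuous_on basin green" using usc[OF continuous_on_id] by simp
  ultimately show ?thesis
    unfolding plurisubharmonic_on_def using finite by blast
qed

text \<open>The orbit is constantly \<open>0\<close>, so only the floor \<open>\<delta> n\<close>
  remains, and \<open>\<delta>_decay\<close> says that \<open>ln (2 * \<delta> n) / 2 ^ n\<close> is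
  unbounded below.\<close>

lemma green_eq_minus_infinity: "G 0 x = 0 \<Longrightarrow> green x = - \<infinity>"
proof -
  assume x: "G 0 x = 0"
  have G0: "G n x = 0" for n
    using orbit_norm_le[of 0 x n] x r by simp
  have "green x \<le> ereal M" for M
  proof -
    obtain n where "ln (2 * \<delta> n) < M * 2 ^ n" using \<delta>_decay by blast
    then have "green_approx n x \<le> M"
      using \<delta>(1)[of n] by (simp add: green_approx_def G0 ln_mult max_absorb2 field_simps)
    then show ?thesis
      unfolding green_def using r by (intro INF_lower2[of n]) (auto simp: G0)
  qed
  then show ?thesis by (rule ereal_bot)
qed

text \<open>Counterpart of \<open>green_eq_minus_infinity\<close>: an orbit that shrinks no faster
  than repeated squaring has a finite value, so \<open>green\<close> is not constant.\<close>

lemma green_lower_bound: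
  assumes "norm (G 0 x) < r" and "\<And>n. M * 2 ^ n \<le> ln (2 * norm (G n x))" and "\<And>n. G n x \<noteq> 0"
  shows "ereal M \<le> green x"
  unfolding green_def
proof (rule INF_greatest)
  fix n
  have "M * 2 ^ n \<le> ln 2 + ln (norm (G n x))" using assms(2,3)[of n] by (simp add: ln_mult)
  also have "ln (norm (G n x)) \<le> ln (max (norm (G n x)) (\<delta> n))" using assms(3) by (intro ln_mono) auto
  finally show "ereal M \<le> ereal (green_approx n x)" by (simp add: green_approx_def field_simps)
qed

text \<open>After entry at time \<open>N\<close> each step at least halves the image of
  \<open>v\<close> under the derivative, and the orbit of \<open>z\<close> tends to
  \<open>0\<close>. Late maps \<open>G (N + m)\<close> therefore meet the requirements of
  \<open>kobayashi_metric_eq_0\<close> with radius \<open>r / 2\<close>, the preimage of the ball of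
  radius \<open>r\<close> lying in the basin.\<close>

lemma kobayashi_basin:
  assumes "z \<in> basin"
  shows "kobayashi_metric basin z v = 0"
proof (rule kobayashi_metric_eq_0[of "r / 2"])
  obtain N where N: "norm (G N z) < r" using assms by (auto simp: basin_def)
  obtain g' where g': "(G N has_derivative g') (at z)"
    using G_aut[of N] unfolding holomorphic_automorphism_def holomorphic_map_on_def by blast
  have deriv: "\<exists>h. (G (N + m) has_derivative h) (at z) \<and> norm (h v) \<le> norm (g' v) / 2 ^ m" for m
  proof (induction m)
    case 0
    then show ?case using g' by auto
  next
    case (Suc m)
    then obtain h where h: "(G (N + m) has_derivative h) (at z)" "norm (h v) \<le> norm (g' v) / 2 ^ m"
      by blast
    obtain F' where F': "(F (N + m) has_derivative F') (at (G (N + m) z))" "\<And>v. norm (F' v) \<le> norm v / 2"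
      using F_deriv[OF orbit_stays[OF N, of "N + m"], of "N + m"] by auto
    have "((F (N + m) \<circ> G (N + m)) has_derivative (F' \<circ> h)) (at z)" by (rule diff_chain_at[OF h(1) F'(1)])
    moreover have "F (N + m) \<circ> G (N + m) = G (N + Suc m)" by (auto simp: G_Suc)
    moreover have "norm ((F' \<circ> h) v) \<le> norm (g' v) / 2 ^ Suc m" using F'(2)[of "h v"] h(2) by simp
    ultimately show ?case by metis
  qed
  fix e :: real assume e: "e > 0"
  have "(\<lambda>m. norm (g' v) * (1/2) ^ m) \<longlonglongrightarrow> norm (g' v) * 0"
    by (intro tendsto_intros LIMSEQ_realpow_zero) auto
  then have "\<forall>\<^sub>F m in sequentially. norm (g' v) * (1/2) ^ m < e"
    using e by (simp add: order_tendstoD)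
  moreover have "(\<lambda>m. G (m + N) z) \<longlonglongrightarrow> 0" by (rule LIMSEQ_ignore_initial_segment[OF orbit_tendsto_0[OF N]])
  then have "\<forall>\<^sub>F m in sequentially. norm (G (m + N) z) < r / 2"
    using tendstoD[of "\<lambda>m. G (m + N) z" 0 sequentially "r / 2"] r by simp
  ultimately have "\<forall>\<^sub>F m in sequentially. norm (g' v) * (1/2) ^ m < e \<and> norm (G (m + N) z) < r / 2"
    by eventually_elim auto
  then obtain m where m: "norm (g' v) * (1/2) ^ m < e" "norm (G (m + N) z) < r / 2"
    by (auto simp: eventually_sequentially)
  obtain h where h: "(G (N + m) has_derivative h) (at z)" "norm (h v) \<le> norm (g' v) / 2 ^ m"
    using deriv by blast
  have "norm (h v) < e" using h(2) m(1) by (simp add: power_divide)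
  then show "\<exists>g g'. holomorphic_automorphism g \<and> {x. g x \<in> ball 0 (2 * (r / 2))} \<subseteq> basin \<and>
               norm (g z) \<le> r / 2 \<and> (g has_derivative g') (at z) \<and> norm (g' v) < e"
    by (intro exI[of _ "G (N + m)"] exI[of _ h] conjI G_aut h(1))
      (use m(2) in \<open>auto simp: basin_def add.commute[of m]\<close>)
qed (use r in simp)

text \<open>Every level is homeomorphic to a ball, and all levels contain the point that
  \<open>G 0\<close> sends to \<open>0\<close>.\<close>

lemma connected_basin: "connected basin"
  unfolding basin_def
proof (rule connected_Union)
  fix S assume "S \<in> range (\<lambda>n. {x. G n x \<in> ball 0 r})"
  then obtain n where S: "S = {x. G n x \<in> ball 0 r}" by blast
  obtain f g where "homeomorphism S (ball (0::complex^'n) 1) f g"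
    using automorphism_preimage_ball[OF G_aut r(1), of n] unfolding S biholomorphic_def by blast
  then have "S homeomorphic (ball (0::complex^'n) 1)" by (auto simp: homeomorphic_def)
  then show "connected S" using homeomorphic_connectedness connected_ball by blast
next
  have "inv (G 0) 0 \<in> {x. G n x \<in> ball 0 r}" for n
  proof -
    have "G 0 (inv (G 0) 0) = 0"
      using G_aut[of 0] by (simp add: holomorphic_automorphism_def bij_is_surj surj_f_inv_f)
    then show ?thesis using orbit_stays[of 0 _ n] r by simp
  qed
  then show "\<Inter> (range (\<lambda>n. {x. G n x \<in> ball 0 r})) \<noteq> {}" by blast
qed

text \<open>The point \<open>x\<close> witnesses that \<open>green\<close> is not constant: it has a
  value of at least \<open>M\<close> there and \<open>-\<infinity>\<close> at
  \<open>inv (G 0) 0\<close>. Properness is assumed here and will come from the disjointness of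
  several basins.\<close>

theorem short_basin:
  assumes proper: "basin \<noteq> UNIV"
    and x: "norm (G 0 x) < r" "\<And>n. M * 2 ^ n \<le> ln (2 * norm (G n x))" "\<And>n. G n x \<noteq> 0"
  shows "short_Ck basin"
proof -
  let ?o = "inv (G 0) 0"
  have o: "G 0 ?o = 0"
    using G_aut[of 0] by (simp add: holomorphic_automorphism_def bij_is_surj surj_f_inv_f)
  have ob: "?o \<in> basin" and xb: "x \<in> basin"
    using o r x(1) unfolding basin_def by (auto intro!: exI[of _ 0])
  have "green ?o \<noteq> green x"
  proof
    assume "green ?o = green x"
    then have "ereal M \<le> - \<infinity>"
      using green_eq_minus_infinity[OF o] green_lower_bound[OF x] by (simp only:)
    then show False by simp
  qed
  then have nonconst: "\<not> green constant_on basin"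
    using ob xb unfolding constant_on_def by metis
  have bdd: "\<forall>z\<in>basin. green z \<le> ereal 0" using green_nonpos by (simp add: zero_ereal_def)
  have op: "open basin" unfolding basin_def using open_levels by blast
  have balls: "\<exists>\<Omega>n :: nat \<Rightarrow> (complex ^ 'n) set.
        basin = (\<Union>n. \<Omega>n n) \<and> (\<forall>n. \<Omega>n n \<subseteq> \<Omega>n (Suc n)) \<and>
        (\<forall>n. biholomorphic (\<Omega>n n) (ball (0 :: complex ^ 'n) 1))"
    by (rule exI[of _ "\<lambda>n. {x. G n x \<in> ball 0 r}"], intro conjI allI basin_def levels_mono
        automorphism_preimage_ball G_aut r) simp
  have "basin \<noteq> {}" using ob by blast
  moreover have "\<exists>M::real. \<forall>z\<in>basin. green z \<le> ereal M" using bdd by (rule exI)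
  ultimately show ?thesis
    unfolding short_Ck_def using nonconst proper kobayashi_basin green_psh op connected_basin balls
    by (intro conjI exI[of _ green]) simp_all
qed

end

section \<open>A sequence of Henon-like maps\<close>

text \<open>The term \<open>z\<^sup>2 / 2\<close> dominates the Taylor remainder, which is at most
  \<open>3/16\<close> of \<open>(cmod z)\<^sup>2\<close>; the constants follow from
  \<open>1/2 + 3/16 \<le> 1\<close> and \<open>1/2 - 3/16 \<ge> 1/4\<close>. The upper bound gives
  superattraction, the lower one keeps an orbit from collapsing too fast.\<close>

lemma exp_near_zero:
  fixes z :: complex
  assumes "cmod z \<le> 1/8"
  shows "cmod (exp z - 1 - z) \<le> (cmod z)\<^sup>2" "(cmod z)\<^sup>2 / 4 \<le> cmod (exp z - 1 - z)"
    "cmod (exp z - 1) \<le> 2 * cmod z"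
proof -
  let ?R = "exp z - 1 - z - z\<^sup>2 / 2"
  have "exp (cmod z) \<le> exp 1" using assms by simp
  then have e: "exp (cmod z) \<le> 3" using exp_le by linarith
  have "cmod ?R \<le> exp (cmod z) * cmod z ^ 3 / 2"
    using Taylor_exp_field[of z 2] by (simp add: numeral_eq_Suc diff_diff_eq add.assoc)
  also have "\<dots> \<le> 3 * cmod z ^ 3 / 2" using e by (intro divide_right_mono mult_right_mono) auto
  also have "\<dots> = 3/2 * cmod z * (cmod z)\<^sup>2" by (simp add: power3_eq_cube power2_eq_square)
  also have "\<dots> \<le> 3/16 * (cmod z)\<^sup>2" using assms by (intro mult_right_mono) auto
  finally have R: "cmod ?R \<le> 3/16 * (cmod z)\<^sup>2" .
  have q: "cmod (z\<^sup>2 / 2) = (cmod z)\<^sup>2 / 2" by (simp add: norm_divide norm_power)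
  have eq: "exp z - 1 - z = z\<^sup>2 / 2 + ?R" by simp
  have "cmod (exp z - 1 - z) \<le> cmod (z\<^sup>2 / 2) + cmod ?R" by (subst eq) (rule norm_triangle_ineq)
  with R q show 1: "cmod (exp z - 1 - z) \<le> (cmod z)\<^sup>2" by (simp add: field_simps) (smt (verit) zero_le_power2)
  have "cmod (z\<^sup>2 / 2) \<le> cmod (exp z - 1 - z) + cmod ?R"
    using norm_triangle_ineq4[of "exp z - 1 - z" ?R] by simp
  then show "(cmod z)\<^sup>2 / 4 \<le> cmod (exp z - 1 - z)" using R q zero_le_power2[of "cmod z"] by linarith
  have "cmod (exp z - 1) \<le> cmod (exp z - 1 - z) + cmod z"
    using norm_triangle_ineq[of "exp z - 1 - z" z] by simp
  also have "(cmod z)\<^sup>2 \<le> cmod z * 1" unfolding power2_eq_square using assms by (intro mult_left_mono) auto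
  ultimately show "cmod (exp z - 1) \<le> 2 * cmod z" using 1 by linarith
qed

definition henon_step :: "'n \<Rightarrow> 'n \<Rightarrow> real \<Rightarrow> complex^'n::finite \<Rightarrow> complex^'n" where
  "henon_step i j \<epsilon> x = (\<chi> l. if l = i then x $ i - (exp (x $ i) - 1 + of_real \<epsilon> * x $ j)
     else if l = j then of_real \<epsilon> * (exp (x $ i) - 1 + of_real \<epsilon> * x $ j)
     else of_real \<epsilon> * x $ l)"

text \<open>The Euclidean norm is at most the sum of the moduli. The lemma separates the main term,
  present in coordinate \<open>i\<close> only, from an error common to all coordinates.\<close>

lemma norm_vec_le_single_plus:
  fixes y :: "complex^'n::finite" and a b :: real
  assumes "\<And>l. cmod (y $ l) \<le> (if l = i then a else 0) + b"
  shows "norm y \<le> a + CARD('n) * b"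
proof -
  have "norm y \<le> (\<Sum>l\<in>UNIV. cmod (y $ l))" unfolding norm_vec_def by (rule L2_set_le_sum) simp
  also have "\<dots> \<le> (\<Sum>l\<in>UNIV. (if l = i then a else 0) + b)" by (rule sum_mono) (rule assms)
  finally show ?thesis by (simp add: sum.distrib)
qed

text \<open>Apart from one linear occurrence in coordinate \<open>i\<close>, the entry
  \<open>x $ i\<close> is used only through \<open>exp\<close>, which has period
  \<open>\<tau>\<close>.\<close>

lemma henon_step_translate:
  assumes "exp \<tau> = 1" "i \<noteq> j"
  shows "henon_step i j \<epsilon> (x - \<tau> *s axis i 1) = henon_step i j \<epsilon> x - \<tau> *s axis i 1"
  using assms by (auto simp: henon_step_def vec_eq_iff axis_def exp_diff)

lemma has_derivative_vec_nth: "((\<lambda>x. x $ l) has_derivative (\<lambda>v. v $ l)) F"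
  by (rule bounded_linear_imp_has_derivative[OF bounded_linear_vec_nth])

lemma has_derivative_complex_cmult:
  assumes "(f has_derivative f') F" shows "((\<lambda>x. c * f x :: complex) has_derivative (\<lambda>v. c * f' v)) F"
  by (rule bounded_linear.has_derivative[OF bounded_linear_mult_right assms])

lemma henon_step_derivative:
  assumes "i \<noteq> j"
  shows "(henon_step i j \<epsilon> has_derivative
     (\<lambda>v. \<chi> l. if l = i then v $ i - (exp (x $ i) * v $ i + of_real \<epsilon> * v $ j)
       else if l = j then of_real \<epsilon> * (exp (x $ i) * v $ i + of_real \<epsilon> * v $ j)
       else of_real \<epsilon> * v $ l)) (at x)"
proof -
  have e: "((\<lambda>x. exp (x $ i)) has_derivative (\<lambda>v. exp (x $ i) * v $ i)) (at x)"
    using has_derivative_compose[OF has_derivative_vec_nth[of i "at x"], of exp "(*) (exp (x $ i))"]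
      DERIV_exp[of "x $ i"] by (simp add: has_field_derivative_def)
  note d = has_derivative_vec_nth[of _ "at x"]
  have s: "((\<lambda>x. exp (x $ i) - 1 + of_real \<epsilon> * x $ j) has_derivative
      (\<lambda>v. exp (x $ i) * v $ i + of_real \<epsilon> * v $ j)) (at x)"
    using has_derivative_add[OF has_derivative_diff[OF e has_derivative_const[of 1]] has_derivative_complex_cmult[OF d]]
    by simp
  show ?thesis
    unfolding henon_step_def[abs_def]
  proof (rule has_derivative_vec_lambda)
    fix l
    consider "l = i" | "l = j" "l \<noteq> i" | "l \<noteq> i" "l \<noteq> j" by blast
    then show "((\<lambda>x. if l = i then x $ i - (exp (x $ i) - 1 + of_real \<epsilon> * x $ j)
           else if l = j then of_real \<epsilon> * (exp (x $ i) - 1 + of_real \<epsilon> * x $ j)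
           else of_real \<epsilon> * x $ l) has_derivative
         (\<lambda>v. if l = i then v $ i - (exp (x $ i) * v $ i + of_real \<epsilon> * v $ j)
           else if l = j then of_real \<epsilon> * (exp (x $ i) * v $ i + of_real \<epsilon> * v $ j)
           else of_real \<epsilon> * v $ l)) (at x)"
      by cases (simp_all add: has_derivative_diff[OF d s] has_derivative_complex_cmult[OF s] has_derivative_complex_cmult[OF d] del: right_diff_distrib distrib_left)
  qed
qed

text \<open>With \<open>s = exp (x $ i) - 1 + \<epsilon> * x $ j\<close>, the image has entries
  \<open>x $ i - s\<close> and \<open>\<epsilon> * s\<close>. The second one determines
  \<open>s\<close>, then the first one \<open>x $ i\<close>, and finally \<open>s\<close> gives
  \<open>x $ j\<close>; this is the inverse \<open>g\<close>.\<close>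

lemma henon_step_automorphism:
  fixes i j :: "'n::finite"
  assumes ij: "i \<noteq> j" and \<epsilon>: "\<epsilon> > 0"
  shows "holomorphic_automorphism (henon_step i j \<epsilon>)"
proof -
  define e where "e = complex_of_real \<epsilon>"
  have e: "e \<noteq> 0" using \<epsilon> by (simp add: e_def)
  have ie: "inverse e * (e * a) = a" "e * (inverse e * a) = a" for a
    using e by (simp_all add: mult.assoc[symmetric])
  define z where "z = (\<lambda>y::complex^'n. y $ i + inverse e * y $ j)"
  define g where "g = (\<lambda>y::complex^'n. \<chi> l. if l = i then z y
     else if l = j then inverse e * (inverse e * y $ j - (exp (z y) - 1)) else inverse e * y $ l)"
  show ?thesis
  proof (rule holomorphic_automorphismI[of g])
    show "g (henon_step i j \<epsilon> x) = x" for x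
      using ij by (simp add: g_def z_def henon_step_def vec_eq_iff ie flip: e_def)
    show "henon_step i j \<epsilon> (g y) = y" for y
      using ij by (simp add: g_def z_def henon_step_def vec_eq_iff ie flip: e_def)
    show "holomorphic_map_on (henon_step i j \<epsilon>) UNIV"
      unfolding holomorphic_map_on_def
      by (intro ballI exI conjI, rule henon_step_derivative[OF ij]) (auto simp: vec_eq_iff algebra_simps)
    show "holomorphic_map_on g UNIV"
      unfolding holomorphic_map_on_def
    proof
      fix y :: "complex^'n"
      define z' where "z' = (\<lambda>v::complex^'n. v $ i + inverse e * v $ j)"
      note d = has_derivative_vec_nth[of _ "at y"]
      have dz: "(z has_derivative z') (at y)"
        unfolding z_def z'_def by (intro has_derivative_add has_derivative_complex_cmult d)
      have ez: "((\<lambda>y. exp (z y)) has_derivative (\<lambda>v. exp (z y) * z' v)) (at y)"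
        using has_derivative_compose[OF dz, of exp "(*) (exp (z y))"] DERIV_exp[of "z y"]
        by (simp add: has_field_derivative_def)
      have s: "((\<lambda>y. inverse e * (inverse e * y $ j - (exp (z y) - 1))) has_derivative
          (\<lambda>v. inverse e * (inverse e * v $ j - (exp (z y) * z' v - 0)))) (at y)"
        by (intro has_derivative_diff has_derivative_complex_cmult d ez has_derivative_const)
      define g' where "g' = (\<lambda>v::complex^'n. \<chi> l. if l = i then z' v
         else if l = j then inverse e * (inverse e * v $ j - (exp (z y) * z' v - 0)) else inverse e * v $ l)"
      have "(g has_derivative g') (at y)"
        unfolding g_def g'_def
      proof (rule has_derivative_vec_lambda)
        fix l
        consider "l = i" | "l = j" "l \<noteq> i" | "l \<noteq> i" "l \<noteq> j" by blast
        then show "((\<lambda>y. if l = i then z y else if l = j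
              then inverse e * (inverse e * y $ j - (exp (z y) - 1)) else inverse e * y $ l)
            has_derivative (\<lambda>v. if l = i then z' v else if l = j
              then inverse e * (inverse e * v $ j - (exp (z y) * z' v - 0)) else inverse e * v $ l)) (at y)"
          using dz s has_derivative_complex_cmult[OF d] by cases (simp_all only: if_True if_False simp_thms)
      qed
      moreover have "g' (c *s v) = c *s g' v" for c v
        by (simp add: g'_def z'_def vec_eq_iff algebra_simps)
      ultimately show "\<exists>f'. (g has_derivative f') (at y) \<and> (\<forall>c v. f' (c *s v) = c *s f' v)"
        by blast
    qed
  qed
qed

section \<open>Estimates for one step near the origin\<close>

context
  fixes i j :: "'n::finite" and \<epsilon> \<delta> :: real and x :: "complex^'n"
  assumes ij: "i \<noteq> j" and \<epsilon>: "0 < \<epsilon>" "CARD('n) * (3 * \<epsilon>) \<le> \<delta>" and \<delta>: "\<delta> \<le> 1/4" and x: "norm x < 1/8"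
begin

lemma henon_\<epsilon>_le: "\<epsilon> \<le> \<delta>" "\<epsilon> \<le> 1"
proof -
  have "1 * (3 * \<epsilon>) \<le> CARD('n) * (3 * \<epsilon>)"
    using \<epsilon>(1) by (intro mult_right_mono) (auto simp: Suc_le_eq)
  then show "\<epsilon> \<le> \<delta>" using \<epsilon> by linarith
  then show "\<epsilon> \<le> 1" using \<delta> by simp
qed

lemma henon_coordinate_small: "cmod (x $ i) \<le> 1/8"
  using Finite_Cartesian_Product.norm_nth_le[of x i] x by linarith

text \<open>Only coordinate \<open>i\<close> carries a quadratic term; what remains in each
  coordinate is at most \<open>3 * \<epsilon> * norm x\<close>. The assumption relating
  \<open>\<epsilon>\<close> to \<open>\<delta>\<close> absorbs the sum of these errors over all
  coordinates.\<close>

lemma henon_step_quadratic: "norm (henon_step i j \<epsilon> x) \<le> (norm x)\<^sup>2 + \<delta> * norm x"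
proof -
  note b = exp_near_zero[OF henon_coordinate_small]
  have "norm (henon_step i j \<epsilon> x) \<le> (norm x)\<^sup>2 + CARD('n) * (3 * \<epsilon> * norm x)"
  proof (rule norm_vec_le_single_plus[where i=i])
    fix l
    have w: "cmod (of_real \<epsilon> * x $ l) \<le> \<epsilon> * norm x" for l
      using \<epsilon>(1) Finite_Cartesian_Product.norm_nth_le[of x l] by (simp add: norm_mult)
    have pos: "0 \<le> \<epsilon> * norm x" using \<epsilon>(1) by simp
    have i: "cmod (x $ i - (exp (x $ i) - 1 + of_real \<epsilon> * x $ j)) \<le> (norm x)\<^sup>2 + \<epsilon> * norm x"
    proof -
      have "x $ i - (exp (x $ i) - 1 + of_real \<epsilon> * x $ j) = - (exp (x $ i) - 1 - x $ i) - of_real \<epsilon> * x $ j"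
        by simp
      then have "cmod (x $ i - (exp (x $ i) - 1 + of_real \<epsilon> * x $ j))
          \<le> cmod (exp (x $ i) - 1 - x $ i) + cmod (of_real \<epsilon> * x $ j)"
        by (metis norm_triangle_ineq4 norm_minus_cancel)
      also have "\<dots> \<le> (norm x)\<^sup>2 + \<epsilon> * norm x"
        using b(1) power_mono[OF Finite_Cartesian_Product.norm_nth_le[of x i] norm_ge_zero, of 2] w[of j] by linarith
      finally show ?thesis .
    qed
    have j: "cmod (of_real \<epsilon> * (exp (x $ i) - 1 + of_real \<epsilon> * x $ j)) \<le> 3 * \<epsilon> * norm x"
    proof -
      have "cmod (exp (x $ i) - 1 + of_real \<epsilon> * x $ j) \<le> 2 * cmod (x $ i) + \<epsilon> * norm x"
        using norm_triangle_ineq[of "exp (x $ i) - 1" "of_real \<epsilon> * x $ j"] b(3) w[of j] by linarith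
      also have "\<dots> \<le> 2 * norm x + 1 * norm x"
        using Finite_Cartesian_Product.norm_nth_le[of x i] henon_\<epsilon>_le by (intro add_mono mult_mono) auto
      finally have "\<epsilon> * cmod (exp (x $ i) - 1 + of_real \<epsilon> * x $ j) \<le> \<epsilon> * (3 * norm x)"
        using \<epsilon>(1) by (intro mult_left_mono) auto
      then show ?thesis using \<epsilon>(1) by (simp add: norm_mult)
    qed
    show "cmod (henon_step i j \<epsilon> x $ l) \<le> (if l = i then (norm x)\<^sup>2 else 0) + 3 * \<epsilon> * norm x"
      using i j w[of l] pos by (simp add: henon_step_def)
  qed
  also have "\<dots> \<le> (norm x)\<^sup>2 + \<delta> * norm x"
    using mult_right_mono[OF \<epsilon>(2) norm_ge_zero[of x]] by (simp add: mult.assoc)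
  finally show ?thesis .
qed

lemma henon_step_half: "norm (henon_step i j \<epsilon> x) \<le> norm x / 2"
proof -
  have "(norm x)\<^sup>2 + \<delta> * norm x \<le> 1/8 * norm x + 1/4 * norm x"
    unfolding power2_eq_square using x \<delta> by (intro add_mono mult_right_mono) auto
  then show ?thesis using henon_step_quadratic norm_ge_zero[of x] by linarith
qed

text \<open>The main entry is multiplied by \<open>1 - exp (x $ i)\<close>, of modulus at most
  \<open>1/4\<close>, and the other terms together contribute at most
  \<open>\<delta> \<le> 1/4\<close>.\<close>

lemma henon_step_derivative_le:
  "\<exists>F'. (henon_step i j \<epsilon> has_derivative F') (at x) \<and> (\<forall>v. norm (F' v) \<le> norm v / 2)"
proof (intro exI conjI allI)
  let ?F' = "\<lambda>v. \<chi> l. if l = i then v $ i - (exp (x $ i) * v $ i + of_real \<epsilon> * v $ j)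
       else if l = j then of_real \<epsilon> * (exp (x $ i) * v $ i + of_real \<epsilon> * v $ j)
       else of_real \<epsilon> * v $ l"
  show "(henon_step i j \<epsilon> has_derivative ?F') (at x)" by (rule henon_step_derivative[OF ij])
  fix v :: "complex^'n"
  have b: "cmod (exp (x $ i) - 1) \<le> 1/4" using exp_near_zero(3)[OF henon_coordinate_small] henon_coordinate_small by linarith
  have "norm (?F' v) \<le> 1/4 * norm v + CARD('n) * (3 * \<epsilon> * norm v)"
  proof (rule norm_vec_le_single_plus[where i=i])
    fix l
    have w: "cmod (of_real \<epsilon> * v $ l) \<le> \<epsilon> * norm v" for l
      using \<epsilon>(1) Finite_Cartesian_Product.norm_nth_le[of v l] by (simp add: norm_mult)
    have pos: "0 \<le> \<epsilon> * norm v" using \<epsilon>(1) by simp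
    have h: "cmod ((exp (x $ i) - 1) * v $ i) \<le> 1/4 * norm v"
      unfolding norm_mult by (rule mult_mono[OF b Finite_Cartesian_Product.norm_nth_le]) auto
    have i: "cmod (v $ i - (exp (x $ i) * v $ i + of_real \<epsilon> * v $ j)) \<le> 1/4 * norm v + \<epsilon> * norm v"
    proof -
      have "v $ i - (exp (x $ i) * v $ i + of_real \<epsilon> * v $ j)
          = - ((exp (x $ i) - 1) * v $ i) - of_real \<epsilon> * v $ j"
        by (simp add: algebra_simps)
      then have "cmod (v $ i - (exp (x $ i) * v $ i + of_real \<epsilon> * v $ j))
          \<le> cmod ((exp (x $ i) - 1) * v $ i) + cmod (of_real \<epsilon> * v $ j)"
        by (metis norm_triangle_ineq4 norm_minus_cancel)
      then show ?thesis using h w[of j] by linarith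
    qed
    have j: "cmod (of_real \<epsilon> * (exp (x $ i) * v $ i + of_real \<epsilon> * v $ j)) \<le> 3 * \<epsilon> * norm v"
    proof -
      have "exp (x $ i) * v $ i + of_real \<epsilon> * v $ j = ((exp (x $ i) - 1) * v $ i + v $ i) + of_real \<epsilon> * v $ j"
        by (simp add: algebra_simps)
      then have "cmod (exp (x $ i) * v $ i + of_real \<epsilon> * v $ j)
          \<le> cmod ((exp (x $ i) - 1) * v $ i) + cmod (v $ i) + cmod (of_real \<epsilon> * v $ j)"
        by (metis norm_triangle_le norm_triangle_ineq add_right_mono)
      also have "\<dots> \<le> 1/4 * norm v + norm v + 1 * norm v"
        using h Finite_Cartesian_Product.norm_nth_le[of v i] w[of j] mult_right_mono[OF henon_\<epsilon>_le(2) norm_ge_zero[of v]] by linarith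
      also have "\<dots> \<le> 3 * norm v" by simp
      finally have "\<epsilon> * cmod (exp (x $ i) * v $ i + of_real \<epsilon> * v $ j) \<le> \<epsilon> * (3 * norm v)"
        using \<epsilon>(1) by (intro mult_left_mono) auto
      then show ?thesis using \<epsilon>(1) by (simp add: norm_mult)
    qed
    show "cmod (?F' v $ l) \<le> (if l = i then 1/4 * norm v else 0) + 3 * \<epsilon> * norm v"
      using i j w[of l] pos by simp
  qed
  also have "CARD('n) * (3 * \<epsilon> * norm v) \<le> \<delta> * norm v"
    using mult_right_mono[OF \<epsilon>(2) norm_ge_zero[of v]] by (simp add: mult.assoc)
  also have "\<delta> * norm v \<le> 1/4 * norm v" using \<delta> by (intro mult_right_mono) auto
  finally show "norm (?F' v) \<le> norm v / 2" by simp
qed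

text \<open>The nonvanishing second-order term of \<open>exp\<close> bounds the new entry from
  below, up to the perturbation by \<open>\<epsilon>\<close>. This is the source of the finite value
  of the Green function.\<close>

lemma henon_step_lower: "(cmod (x $ i))\<^sup>2 / 4 - \<delta> \<le> cmod (henon_step i j \<epsilon> x $ i)"
proof -
  have "cmod (of_real \<epsilon> * x $ j) \<le> \<epsilon> * 1"
    using \<epsilon>(1) Finite_Cartesian_Product.norm_nth_le[of x j] x by (simp add: norm_mult)
  moreover have "cmod (exp (x $ i) - 1 - x $ i) - cmod (of_real \<epsilon> * x $ j)
      \<le> cmod (- (exp (x $ i) - 1 - x $ i) - of_real \<epsilon> * x $ j)"
    using norm_triangle_ineq2[of "- (exp (x $ i) - 1 - x $ i)" "of_real \<epsilon> * x $ j"]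
    by (simp only: norm_minus_cancel)
  moreover have "- (exp (x $ i) - 1 - x $ i) - of_real \<epsilon> * x $ j = henon_step i j \<epsilon> x $ i"
    by (simp add: henon_step_def)
  ultimately show ?thesis using exp_near_zero(2)[OF henon_coordinate_small] henon_\<epsilon>_le(1) by simp
qed

end

section \<open>Compositions of the steps and choice of the constants\<close>

primrec iterates :: "(nat \<Rightarrow> 'a \<Rightarrow> 'a) \<Rightarrow> ('b \<Rightarrow> 'a) \<Rightarrow> nat \<Rightarrow> 'b \<Rightarrow> 'a" where
  "iterates F A 0 = A"
| "iterates F A (Suc n) = F n \<circ> iterates F A n"

text \<open>Every step commutes with the translation, so a shift of the start map persists unchanged
  through all iterates. This is how different basins are compared.\<close>

lemma henon_iterates_translate:
  assumes "exp \<tau> = 1" "i \<noteq> j"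
  shows "iterates (\<lambda>n. henon_step i j (\<epsilon> n)) (\<lambda>x. A x - \<tau> *s axis i 1) n x
    = iterates (\<lambda>n. henon_step i j (\<epsilon> n)) A n x - \<tau> *s axis i 1"
  by (induction n) (simp_all add: henon_step_translate[OF assms])

text \<open>The exponents grow faster than \<open>2\<^sup>n\<close>, so that the limit function is \<open>-\<infinity>\<close> at the fixed point.
  The base is chosen so that the first coordinates of the orbit of \<open>axis i (1/16)\<close>, which are nearly
  squared in each step, stay above \<open>8 * (1/128) ^ (2 ^ n)\<close>.\<close>

definition henon_\<delta> :: "nat \<Rightarrow> real" where
  "henon_\<delta> n = (1/128) ^ (2 * 3 ^ n) / 2"

text \<open>The exponent \<open>2 * 2 ^ n\<close> is \<open>2 ^ Suc n\<close>, the one in the orbit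
  bound at the next time, so the perturbation is small against the squared entry.\<close>

lemma henon_\<delta>_le: "henon_\<delta> n \<le> (1/128) ^ (2 * 2 ^ n)"
proof -
  have "(1/128 :: real) ^ (2 * 3 ^ n) \<le> (1/128) ^ (2 * 2 ^ n)"
    by (intro power_decreasing mult_left_mono power_mono) auto
  moreover have "(0::real) \<le> (1/128) ^ (2 * 3 ^ n)" by simp
  ultimately show ?thesis unfolding henon_\<delta>_def by linarith
qed

lemma henon_\<delta>_bounds:
  "0 < henon_\<delta> n" "henon_\<delta> n \<le> 1/4" "henon_\<delta> (Suc n) \<le> 2 * (henon_\<delta> n)\<^sup>2"
proof -
  show "0 < henon_\<delta> n" by (simp add: henon_\<delta>_def)
  have "(1/128 :: real) ^ (2 * 2 ^ n) \<le> (1/128) ^ 1" by (intro power_decreasing) auto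
  then show "henon_\<delta> n \<le> 1/4" using henon_\<delta>_le[of n] by simp
  \<comment> \<open>Squaring doubles the exponent while passing to \<open>Suc n\<close> triples
    it.\<close>
  have "(1/128 :: real) ^ (2 * 3 ^ Suc n) \<le> (1/128) ^ (2 * 3 ^ n * 2)" by (intro power_decreasing) auto
  then show "henon_\<delta> (Suc n) \<le> 2 * (henon_\<delta> n)\<^sup>2"
    unfolding henon_\<delta>_def power_divide power_mult[symmetric] by simp
qed

text \<open>Here \<open>ln (2 * henon_\<delta> n)\<close> equals \<open>- c * 3 ^ n\<close>, and
  \<open>(3/2) ^ n\<close> is unbounded.\<close>

lemma henon_\<delta>_decay: "\<exists>n. ln (2 * henon_\<delta> n) < M * 2 ^ n"
proof -
  define c where "c = 2 * ln (128 :: real)"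
  have c: "c > 0" by (simp add: c_def)
  obtain n where n: "- M / c < (3/2) ^ n" using real_arch_pow[of "3/2" "- M / c"] by auto
  then have "- M < (3/2) ^ n * c" using c by (simp add: field_simps)
  then have "- M * 2 ^ n < (3/2) ^ n * c * 2 ^ n" by (intro mult_strict_right_mono) auto
  also have "\<dots> = 3 ^ n * c" by (simp add: power_divide)
  also have "\<dots> = - ln (2 * henon_\<delta> n)" by (simp add: henon_\<delta>_def c_def ln_realpow ln_div)
  finally show ?thesis by (intro exI[of _ n]) simp
qed

context
  fixes i j :: "'n::finite" and \<epsilon> :: "nat \<Rightarrow> real" and A :: "complex^'n \<Rightarrow> complex^'n"
  assumes ij: "i \<noteq> j" and A: "holomorphic_automorphism A"
    and \<epsilon>: "\<And>n. \<epsilon> n = henon_\<delta> n / (3 * CARD('n))"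
begin

lemma henon_\<epsilon>: "0 < \<epsilon> n" "CARD('n) * (3 * \<epsilon> n) \<le> henon_\<delta> n"
  using henon_\<delta>_bounds(1)[of n] by (simp_all add: \<epsilon>)

lemmas henon_facts = ij henon_\<epsilon> henon_\<delta>_bounds(2)

lemma henon_superattracting:
  "superattracting_basin (\<lambda>n. henon_step i j (\<epsilon> n))
     (iterates (\<lambda>n. henon_step i j (\<epsilon> n)) A) (1/8) henon_\<delta>"
proof
  fix n
  show "holomorphic_automorphism (iterates (\<lambda>n. henon_step i j (\<epsilon> n)) A n)"
    by (induction n)
      (simp_all only: iterates.simps A holomorphic_automorphism_compose henon_step_automorphism[OF ij henon_\<epsilon>(1)])
  show "henon_\<delta> n < 1/2" using henon_\<delta>_bounds(2)[of n] by simp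
next
  fix n and x :: "complex^'n" assume "norm x < 1/8"
  note facts = henon_facts this
  show "\<exists>F'. (henon_step i j (\<epsilon> n) has_derivative F') (at x) \<and> (\<forall>v. norm (F' v) \<le> norm v / 2)"
    by (rule henon_step_derivative_le[OF facts])
  show "norm (henon_step i j (\<epsilon> n) x) \<le> norm x / 2" by (rule henon_step_half[OF facts])
  show "norm (henon_step i j (\<epsilon> n) x) \<le> (norm x)\<^sup>2 + henon_\<delta> n * norm x"
    by (rule henon_step_quadratic[OF facts])
qed (simp_all add: henon_\<delta>_bounds henon_\<delta>_decay)

text \<open>The orbit starting at \<open>axis i (1/16)\<close> shrinks only like
  \<open>(1/128) ^ (2 ^ n)\<close>, so \<open>short_basin\<close> applies with
  \<open>M = ln (1/128)\<close>.\<close>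

lemma short_Ck_henon_basin:
  assumes "superattracting_basin.basin (iterates (\<lambda>n. henon_step i j (\<epsilon> n)) A) (1/8) \<noteq> UNIV"
  shows "short_Ck (superattracting_basin.basin (iterates (\<lambda>n. henon_step i j (\<epsilon> n)) A) (1/8))"
proof -
  interpret superattracting_basin "\<lambda>n. henon_step i j (\<epsilon> n)"
    "iterates (\<lambda>n. henon_step i j (\<epsilon> n)) A" "1/8" henon_\<delta> by (rule henon_superattracting)
  let ?G = "iterates (\<lambda>n. henon_step i j (\<epsilon> n)) A"
  define x where "x = inv A (axis i (1/16))"
  have Ax: "A x = axis i (1/16)"
    using A by (simp add: x_def holomorphic_automorphism_def bij_is_surj surj_f_inv_f)
  have x0: "norm (?G 0 x) < 1/8" by (simp add: Ax norm_axis_complex norm_divide)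
  have lower: "8 * (1/128) ^ (2 ^ n) \<le> cmod (?G n x $ i)" for n
  proof (induction n)
    case 0
    then show ?case by (simp add: Ax axis_def norm_divide)
  next
    case (Suc n)
    let ?s = "(1/128 :: real) ^ (2 ^ n)"
    \<comment> \<open>With \<open>q = ?s\<^sup>2\<close> the lower estimate for one step gives at
      least \<open>64 * q / 4 - q = 15 * q\<close>, more than the required \<open>8 * q\<close>. The
      induction starts with equality, as \<open>1/16 = 8 * (1/128)\<close>.\<close>
    have "(8 * ?s)\<^sup>2 \<le> (cmod (?G n x $ i))\<^sup>2" by (intro power_mono Suc) auto
    moreover have "(8 * ?s)\<^sup>2 = 64 * (1/128) ^ (2 ^ Suc n)"
      unfolding power_mult_distrib power_mult[symmetric] by (simp add: mult.commute)
    moreover have "henon_\<delta> n \<le> (1/128) ^ (2 ^ Suc n)" using henon_\<delta>_le[of n] by simp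
    moreover have "(0::real) \<le> (1/128) ^ (2 ^ Suc n)" by simp
    moreover have "(cmod (?G n x $ i))\<^sup>2 / 4 - henon_\<delta> n \<le> cmod (?G (Suc n) x $ i)"
      using henon_step_lower[OF henon_facts orbit_stays[OF x0, of n], of n] by simp
    ultimately show ?case by linarith
  qed
  have nrm: "8 * (1/128) ^ (2 ^ n) \<le> norm (?G n x)" for n
    using lower[of n] Finite_Cartesian_Product.norm_nth_le[of "?G n x" i] by linarith
  have pos: "(0::real) < (1/128) ^ (2 ^ n)" for n :: nat by simp
  show ?thesis
  proof (rule short_basin[OF assms x0])
    fix n
    have "(1/128) ^ (2 ^ n) \<le> 2 * norm (?G n x)" using nrm[of n] pos[of n] by linarith
    then have "ln ((1/128) ^ (2 ^ n)) \<le> ln (2 * norm (?G n x))" using pos[of n] by (intro ln_mono) auto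
    then show "ln (1/128) * 2 ^ n \<le> ln (2 * norm (?G n x))" by (simp add: ln_realpow mult.commute)
    show "?G n x \<noteq> 0" using nrm[of n] pos[of n] by (metis norm_zero not_le mult_pos_pos zero_less_numeral)
  qed
qed

end

section \<open>Disjoint basins along a tame sequence\<close>

lemma scaled_translate_automorphism:
  assumes "c \<noteq> 0"
  shows "holomorphic_automorphism (\<lambda>x::complex^'n::finite. c *s x - b)"
proof -
  have d: "((\<lambda>x. c *s x - b) has_derivative (\<lambda>v. c *s v)) (at x)" for c and b x :: "complex^'n"
    using has_derivative_diff[OF bounded_linear_imp_has_derivative[OF bounded_linear_vec_mult] has_derivative_const]
    by simp
  have h: "holomorphic_map_on (\<lambda>x::complex^'n. c *s x - b) UNIV" for c b
    unfolding holomorphic_map_on_def by (intro ballI exI conjI, rule d) (auto simp: vec_eq_iff)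
  show ?thesis
    by (rule holomorphic_automorphismI[of "\<lambda>y. inverse c *s y - (- inverse c *s b)", OF _ _ h h])
      (use assms in \<open>auto simp: vec_eq_iff field_simps\<close>)
qed

theorem proposition2p1:
  fixes p :: "nat \<Rightarrow> complex ^ 'n::finite" and i\<^sub>1 :: 'n
  assumes "CARD('n) \<ge> 2"
    and "tame i\<^sub>1 p"
  shows "\<exists>\<Omega> :: nat \<Rightarrow> (complex ^ 'n) set.
           (\<forall>j. short_Ck (\<Omega> j)) \<and> disjoint_family \<Omega> \<and> (\<forall>j. p j \<in> \<Omega> j)"
proof -
  have "\<exists>k. i\<^sub>1 \<noteq> k"
  proof (rule ccontr)
    assume "\<not> ?thesis"
    then have "UNIV = {i\<^sub>1}" by auto
    then have "CARD('n) = card {i\<^sub>1}" by (rule arg_cong)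
    with assms(1) show False by simp
  qed
  then obtain i\<^sub>2 where ne: "i\<^sub>1 \<noteq> i\<^sub>2" by blast
  obtain \<phi> where \<phi>: "holomorphic_automorphism \<phi>" "\<And>j. \<phi> (p j) = of_nat j *s axis i\<^sub>1 1"
    using assms(2) unfolding tame_def by blast
  define \<epsilon> where "\<epsilon> = (\<lambda>n. henon_\<delta> n / (3 * CARD('n)))"
  define F where "F = (\<lambda>n. henon_step i\<^sub>1 i\<^sub>2 (\<epsilon> n))"
  define \<tau> where "\<tau> = (\<lambda>a::nat. of_nat a * (2 * of_real pi * \<i>))"
  \<comment> \<open>The scaling places the points \<open>\<phi> (p j)\<close> at multiples of the
    period of \<open>exp\<close>, and subtracting \<open>\<tau> a\<close> moves the image of
    \<open>p a\<close> to the origin.\<close>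
  define A where "A = (\<lambda>a x. (2 * of_real pi * \<i>) *s \<phi> x - \<tau> a *s axis i\<^sub>1 1)"
  define \<Omega> where "\<Omega> = (\<lambda>a. superattracting_basin.basin (iterates F (A a)) (1/8))"
  have exp_\<tau>: "exp (\<tau> a) = 1" for a
  proof -
    have "Re (\<tau> a) = 0" "Im (\<tau> a) = of_int (2 * int a) * pi" by (simp_all add: \<tau>_def)
    then show ?thesis unfolding exp_eq_1 by blast
  qed
  have A_aut: "holomorphic_automorphism (A a)" for a
    using holomorphic_automorphism_compose[OF \<phi>(1) scaled_translate_automorphism[of "2 * of_real pi * \<i>"]]
    by (simp add: A_def o_def)
  have basin: "superattracting_basin F (iterates F (A a)) (1/8) henon_\<delta>" for a
    unfolding F_def by (rule henon_superattracting[OF ne A_aut]) (simp add: \<epsilon>_def)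
  have mem: "x \<in> \<Omega> a \<longleftrightarrow> (\<exists>n. norm (iterates F (A a) n x) < 1/8)" for a x
    unfolding \<Omega>_def superattracting_basin.basin_def[OF basin] by simp
  have p_mem: "p a \<in> \<Omega> a" for a
    unfolding mem by (rule exI[of _ 0]) (simp add: A_def \<phi>(2) \<tau>_def mult.commute)
  have disj: "\<Omega> a \<inter> \<Omega> b = {}" if "a \<noteq> b" for a b
  proof (rule ccontr)
    assume "\<Omega> a \<inter> \<Omega> b \<noteq> {}"
    then obtain x m n where "norm (iterates F (A a) m x) < 1/8" "norm (iterates F (A b) n x) < 1/8"
      by (auto simp: mem)
    then have lt: "norm (iterates F (A a) (max m n) x) < 1/8" "norm (iterates F (A b) (max m n) x) < 1/8"
      using superattracting_basin.orbit_stays[OF basin] by (metis max.cobounded1, metis max.cobounded2)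
    \<comment> \<open>All the iterates are translates of one common sequence. A point in two basins
      would have both its orbits within \<open>1/8\<close> of \<open>0\<close> at the common time
      \<open>max m n\<close>, although they differ by a vector of norm at least
      \<open>2 * pi\<close>.\<close>
    have "iterates F (A c) k x = iterates F (\<lambda>x. (2 * of_real pi * \<i>) *s \<phi> x) k x - \<tau> c *s axis i\<^sub>1 1" for c k
      unfolding F_def A_def by (rule henon_iterates_translate[OF exp_\<tau> ne])
    then have "iterates F (A a) (max m n) x - iterates F (A b) (max m n) x = axis i\<^sub>1 (\<tau> b - \<tau> a)"
      by (simp add: vec_eq_iff axis_def)
    then have "cmod (\<tau> b - \<tau> a) < 1/8 + 1/8"
      using norm_triangle_ineq4[of "iterates F (A a) (max m n) x" "iterates F (A b) (max m n) x"] lt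
      by (simp add: norm_axis_complex)
    moreover have "\<tau> b - \<tau> a = of_int (int b - int a) * (2 * of_real pi * \<i>)"
      by (simp add: \<tau>_def algebra_simps)
    then have "cmod (\<tau> b - \<tau> a) = \<bar>of_int (int b - int a)\<bar> * (2 * pi)"
      by (simp only: norm_mult norm_of_int) (simp add: norm_mult)
    moreover have "1 \<le> \<bar>real_of_int (int b - int a)\<bar>" using that by linarith
    then have "1 * (2 * 2) \<le> \<bar>real_of_int (int b - int a)\<bar> * (2 * pi)"
      using pi_ge_two by (intro mult_mono) auto
    ultimately show False by linarith
  qed
  \<comment> \<open>Properness follows from disjointness: the basin misses
    \<open>p (Suc a)\<close>.\<close>
  have "\<Omega> a \<noteq> UNIV" for a using disj[of a "Suc a"] p_mem[of "Suc a"] by auto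
  then have "short_Ck (\<Omega> a)" for a
    unfolding \<Omega>_def F_def by (intro short_Ck_henon_basin[OF ne A_aut]) (simp_all add: \<epsilon>_def)
  then show ?thesis
    using disj p_mem by (intro exI[of _ \<Omega>]) (simp add: disjoint_family_on_def)
qed

end
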